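(* Let $m>1$ be an integer, let $\ell$ be an odd integer, and let $H$ be the finite $2$-group with generators $A,B$ defined in the context. For every $x,y\in Z_2(H)$ the assignment $A\mapsto Ax$, $B\mapsto By$ extends to a 2-central automorphism $\Pi_{(x,y)}$ of $H$ that fixes $Z_2(H)$ pointwise. Moreover, the corresponding map $\Pi:Z_2(H)\times Z_2(H)\to\mathrm{Aut}(H)$, $(x,y)\mapsto\Pi_{(x,y)}$, is a group monomorphism whose image is $\mathrm{Aut}_2(H)$. In particular, $|\mathrm{Aut}_2(H)|=2^{6m-4}$.
   Context: Notation: $[a,b]=a^{-1}b^{-1}ab$, $b^a=a^{-1}ba$, $\alpha=1+2^m\ell$. Let $$J=\langle A,B\mid A^{[A,B]}=A^{\alpha},\ B^{[B,A]}=B^{\alpha},\ A^{2^{3m-1}}=B^{2^{3m-1}}=1\rangle$$ and $H=J/Z(J)$, which has the presentation $$H=\langle A,B\mid A^{[A,B]}=A^{\alpha},\ B^{[B,A]}=B^{\alpha},\ A^{2^{2m-1}}=B^{2^{2m-1}}=1\rangle.$$ For a group $T$, $Z_0(T)=1, Z_1(T),Z_2(T),\dots$ denotes the upper central series, and $\mathrm{Aut}_i(T)$ is the kernel of the canonical map $\mathrm{Aut}(T)\to\mathrm{Aut}(T/Z_i(T))$. An automorphism of $T$ is $i$-central if it belongs to $\mathrm{Aut}_i(T)$. *)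

theory Defs
  imports "HOL-Algebra.Algebra"
begin

section \<open>Free groups and presentations\<close>

text \<open>The letter \<open>(g, True)\<close> stands for the generator \<open>g\<close> and \<open>(g, False)\<close> for its formal inverse.\<close>

type_synonym 'g fword = "('g \<times> bool) list"

inductive word_eq :: "'g fword \<Rightarrow> 'g fword \<Rightarrow> bool" where
  refl: "word_eq u u"
| sym: "word_eq u v \<Longrightarrow> word_eq v u"
| trans: "word_eq u v \<Longrightarrow> word_eq v w \<Longrightarrow> word_eq u w"
| cancel: "word_eq (u @ [(g, b), (g, \<not> b)] @ v) (u @ v)"

definition word_class :: "'g fword \<Rightarrow> 'g fword set" where
  "word_class u = {v. word_eq u v}"

text \<open>The free group on the whole type \<open>'g\<close>.\<close>

definition free_group :: "'g fword set monoid" where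
  "free_group =
    \<lparr>carrier = range word_class,
     monoid.mult = (\<lambda>U V. {w. \<exists>u\<in>U. \<exists>v\<in>V. word_eq (u @ v) w}),
     one = word_class []\<rparr>"

definition free_gen :: "'g \<Rightarrow> 'g fword set" where
  "free_gen g = word_class [(g, True)]"

definition normal_closure :: "('a, 'b) monoid_scheme \<Rightarrow> 'a set \<Rightarrow> 'a set" where
  "normal_closure G R =
    generate G {inv\<^bsub>G\<^esub> g \<otimes>\<^bsub>G\<^esub> r \<otimes>\<^bsub>G\<^esub> g | g r. g \<in> carrier G \<and> r \<in> R}"

text \<open>\<open>G\<close> has the presentation \<open>\<langle>'g | R\<rangle>\<close>, the generator \<open>g\<close> being interpreted as \<open>f g \<in> G\<close>.
  A relation \<open>u = v\<close> is encoded by the relator \<open>u v\<^sup>-\<^sup>1\<close>.\<close>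

definition has_presentation ::
    "('a, 'b) monoid_scheme \<Rightarrow> ('g \<Rightarrow> 'a) \<Rightarrow> 'g fword set set \<Rightarrow> bool" where
  "has_presentation G f R \<longleftrightarrow> group G \<and>
    (\<exists>\<phi> \<in> hom free_group G.
        (\<forall>g. \<phi> (free_gen g) = f g) \<and>
        \<phi> ` carrier free_group = carrier G \<and>
        kernel free_group G \<phi> = normal_closure free_group R)"


section \<open>The relators of the group \<open>H\<close>\<close>

definition commutator :: "('a, 'b) monoid_scheme \<Rightarrow> 'a \<Rightarrow> 'a \<Rightarrow> 'a" where
  "commutator G a b = inv\<^bsub>G\<^esub> a \<otimes>\<^bsub>G\<^esub> inv\<^bsub>G\<^esub> b \<otimes>\<^bsub>G\<^esub> a \<otimes>\<^bsub>G\<^esub> b"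

text \<open>\<open>conjugate G b a\<close> is \<open>b\<^sup>a\<close>.\<close>

definition conjugate :: "('a, 'b) monoid_scheme \<Rightarrow> 'a \<Rightarrow> 'a \<Rightarrow> 'a" where
  "conjugate G b a = inv\<^bsub>G\<^esub> a \<otimes>\<^bsub>G\<^esub> b \<otimes>\<^bsub>G\<^esub> a"

datatype gen = GenA | GenB

definition H_relators :: "nat \<Rightarrow> int \<Rightarrow> gen fword set set" where
  "H_relators m l =
    (let F = free_group; A = free_gen GenA; B = free_gen GenB; \<alpha> = 1 + 2 ^ m * l in
      {conjugate F A (commutator F A B) \<otimes>\<^bsub>F\<^esub> inv\<^bsub>F\<^esub> (A [^]\<^bsub>F\<^esub> \<alpha>),
       conjugate F B (commutator F B A) \<otimes>\<^bsub>F\<^esub> inv\<^bsub>F\<^esub> (B [^]\<^bsub>F\<^esub> \<alpha>),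
       A [^]\<^bsub>F\<^esub> ((2::nat) ^ (2 * m - 1)),
       B [^]\<^bsub>F\<^esub> ((2::nat) ^ (2 * m - 1))})"


section \<open>Upper central series and central automorphisms\<close>

definition center :: "('a, 'b) monoid_scheme \<Rightarrow> 'a set" where
  "center G = {z \<in> carrier G. \<forall>g \<in> carrier G. z \<otimes>\<^bsub>G\<^esub> g = g \<otimes>\<^bsub>G\<^esub> z}"

primrec upper_central :: "('a, 'b) monoid_scheme \<Rightarrow> nat \<Rightarrow> 'a set" where
  "upper_central G 0 = {\<one>\<^bsub>G\<^esub>}"
| "upper_central G (Suc i) =
    {x \<in> carrier G. upper_central G i #>\<^bsub>G\<^esub> x \<in> center (G Mod upper_central G i)}"

definition induced_auto ::
    "('a, 'b) monoid_scheme \<Rightarrow> 'a set \<Rightarrow> ('a \<Rightarrow> 'a) \<Rightarrow> 'a set \<Rightarrow> 'a set" where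
  "induced_auto G N \<sigma> = (\<lambda>C \<in> carrier (G Mod N). \<sigma> ` C)"

definition central_autos :: "('a, 'b) monoid_scheme \<Rightarrow> nat \<Rightarrow> ('a \<Rightarrow> 'a) set" where
  "central_autos G i =
    kernel (AutoGroup G) (AutoGroup (G Mod upper_central G i)) (induced_auto G (upper_central G i))"


section \<open>Basic facts\<close>

lemma word_eq_append_left: "word_eq u v \<Longrightarrow> word_eq (w @ u) (w @ v)"
proof (induction rule: word_eq.induct)
  case (cancel u g b v)
  then show ?case using word_eq.cancel[of "w @ u" g b v] by simp
qed (blast intro: word_eq.intros)+

lemma word_eq_append_right: "word_eq u v \<Longrightarrow> word_eq (u @ w) (v @ w)"
proof (induction rule: word_eq.induct)
  case (cancel u g b v)
  then show ?case using word_eq.cancel[of u g b "v @ w"] by simp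
qed (blast intro: word_eq.intros)+

lemma word_eq_append:
  "word_eq u u' \<Longrightarrow> word_eq v v' \<Longrightarrow> word_eq (u @ v) (u' @ v')"
  by (meson word_eq.trans word_eq_append_left word_eq_append_right)

lemma word_class_eq_iff: "word_class u = word_class v \<longleftrightarrow> word_eq u v"
  unfolding word_class_def using word_eq.intros(1-3) by blast

lemma free_group_mult:
  "word_class u \<otimes>\<^bsub>free_group\<^esub> word_class v = word_class (u @ v)"
  unfolding free_group_def word_class_def
  by (auto intro: word_eq.intros word_eq_append)

lemma free_group_one: "\<one>\<^bsub>free_group\<^esub> = word_class []"
  and free_group_carrier: "carrier free_group = range word_class"
  by (simp_all add: free_group_def)

definition word_inv :: "'g fword \<Rightarrow> 'g fword" where
  "word_inv u = rev (map (\<lambda>(g, b). (g, \<not> b)) u)"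

lemma word_inv_left: "word_eq (word_inv u @ u) []"
proof (induction u)
  case (Cons a u)
  obtain g b where a: "a = (g, b)" by force
  have "word_eq (word_inv u @ [(g, \<not> b), (g, \<not> \<not> b)] @ u) (word_inv u @ u)"
    by (rule word_eq.cancel)
  then have "word_eq (word_inv (a # u) @ a # u) (word_inv u @ u)"
    by (simp add: word_inv_def a)
  with Cons show ?case by (blast intro: word_eq.trans)
qed (simp add: word_inv_def word_eq.refl)

lemma group_free_group: "group free_group"
proof (rule groupI)
  fix x assume "x \<in> carrier free_group"
  then obtain u where "x = word_class u" by (auto simp: free_group_carrier)
  then show "\<exists>y\<in>carrier free_group. y \<otimes>\<^bsub>free_group\<^esub> x = \<one>\<^bsub>free_group\<^esub>"
    using word_inv_left[of u]
    by (auto simp: free_group_carrier free_group_mult free_group_one word_class_eq_iff)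
qed (auto simp: free_group_carrier free_group_mult free_group_one)

primrec eval_word :: "('a, 'b) monoid_scheme \<Rightarrow> ('g \<Rightarrow> 'a) \<Rightarrow> 'g fword \<Rightarrow> 'a" where
  "eval_word G f [] = \<one>\<^bsub>G\<^esub>"
| "eval_word G f (a # u) =
    (if snd a then f (fst a) else inv\<^bsub>G\<^esub> f (fst a)) \<otimes>\<^bsub>G\<^esub> eval_word G f u"

context group
begin

lemma eval_word_closed:
  "(\<And>g. f g \<in> carrier G) \<Longrightarrow> eval_word G f u \<in> carrier G"
  by (induction u) auto

lemma eval_word_append:
  "(\<And>g. f g \<in> carrier G) \<Longrightarrow>
    eval_word G f (u @ v) = eval_word G f u \<otimes> eval_word G f v"
  by (induction u) (auto simp: eval_word_closed m_assoc)

lemma eval_word_cong: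
  assumes f: "\<And>g. f g \<in> carrier G"
  shows "word_eq u v \<Longrightarrow> eval_word G f u = eval_word G f v"
proof (induction rule: word_eq.induct)
  case (cancel u g b v)
  have "eval_word G f [(g, b), (g, \<not> b)] = \<one>" using f[of g] by simp
  then show ?case
    using eval_word_append[of f, OF f] eval_word_closed[of f, OF f] by (metis l_one)
qed auto

text \<open>The universal property of the free group.\<close>

lemma free_group_extend:
  assumes f: "\<And>g. f g \<in> carrier G"
  obtains \<phi> where "\<phi> \<in> hom free_group G" "\<And>g. \<phi> (free_gen g) = f g"
    "\<And>u. \<phi> (word_class u) = eval_word G f u"
proof -
  define \<phi> where "\<phi> U = eval_word G f (SOME u. u \<in> U)" for U
  have \<phi>: "\<phi> (word_class u) = eval_word G f u" for u
  proof -
    have "word_eq u (SOME v. v \<in> word_class u)"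
      unfolding word_class_def mem_Collect_eq by (rule someI) (rule word_eq.refl)
    then show ?thesis unfolding \<phi>_def by (metis eval_word_cong[of f, OF f])
  qed
  have "\<phi> \<in> hom free_group G"
    by (rule homI)
      (auto simp: free_group_carrier free_group_mult \<phi> f eval_word_closed eval_word_append)
  moreover have "\<phi> (free_gen g) = f g" for g
    using f[of g] by (simp add: free_gen_def \<phi>)
  ultimately show thesis using \<phi> that by blast
qed

lemma normal_closure_normal:
  assumes R: "R \<subseteq> carrier G"
  shows "normal_closure G R \<lhd> G"
proof -
  let ?S = "{inv g \<otimes> r \<otimes> g | g r. g \<in> carrier G \<and> r \<in> R}"
  have S: "?S \<subseteq> carrier G" using R by auto
  have "h \<otimes> s \<otimes> inv h \<in> ?S" if "s \<in> ?S" "h \<in> carrier G" for s h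
  proof -
    obtain g r where gr: "g \<in> carrier G" "r \<in> R" "s = inv g \<otimes> r \<otimes> g" using \<open>s \<in> ?S\<close> by blast
    have "r \<in> carrier G" using gr R by blast
    then have "h \<otimes> s \<otimes> inv h = inv (g \<otimes> inv h) \<otimes> r \<otimes> (g \<otimes> inv h)"
      using gr(1,3) \<open>h \<in> carrier G\<close> by (simp add: inv_mult_group m_assoc)
    moreover have "g \<otimes> inv h \<in> carrier G" using gr(1) \<open>h \<in> carrier G\<close> by simp
    ultimately show ?thesis using gr(2) by blast
  qed
  then show ?thesis unfolding normal_closure_def by (rule normal_generateI[OF S])
qed

end

text \<open>Every presentation is realised by the corresponding quotient of the free group.\<close>

lemma has_presentation_exists:
  assumes R: "R \<subseteq> carrier free_group"
  shows "has_presentation (free_group Mod normal_closure free_group R)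
    (\<lambda>g. normal_closure free_group R #>\<^bsub>free_group\<^esub> free_gen g) R"
proof -
  interpret N: normal "normal_closure free_group R" free_group
    by (rule group.normal_closure_normal[OF group_free_group R])
  let ?N = "normal_closure free_group R"
  let ?\<phi> = "\<lambda>x. ?N #>\<^bsub>free_group\<^esub> x"
  have "?\<phi> \<in> hom free_group (free_group Mod ?N)" by (rule N.r_coset_hom_Mod)
  moreover have "?\<phi> ` carrier free_group = carrier (free_group Mod ?N)"
    by (auto simp: FactGroup_def RCOSETS_def)
  moreover have "kernel free_group (free_group Mod ?N) ?\<phi> = ?N"
    using N.coset_join1 N.rcos_const N.subgroup_axioms N.subset
    by (auto simp: kernel_def FactGroup_def)
  ultimately show ?thesis
    unfolding has_presentation_def using N.factorgroup_is_group by blast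
qed

lemma H_relators_closed: "H_relators m l \<subseteq> carrier free_group"
proof -
  interpret F: group free_group by (rule group_free_group)
  have "free_gen g \<in> carrier free_group" for g :: gen
    by (simp add: free_gen_def free_group_carrier)
  then show ?thesis
    by (simp add: H_relators_def Let_def conjugate_def commutator_def)
qed

end

theory Submission
  imports Defs
begin

text \<open>
  Put \<open>C = [A, B]\<close> and \<open>q = 2\<^sup>2\<^sup>m\<^sup>-\<^sup>1\<close>. The relations say that \<open>A B = B A C\<close>, \<open>A C = C A\<^sup>\<alpha>\<close> and
  \<open>C B = B\<^sup>\<alpha> C\<close>, so every element of \<open>H\<close> can be collected to the form \<open>B\<^sup>j A\<^sup>i C\<^sup>k\<close>
  (\<open>nf_surj\<close>). Because \<open>(\<alpha> - 1)\<^sup>2\<close> is divisible by \<open>q\<close>, the exponents produced by the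
  collection are polynomials that can be written down explicitly. These polynomials define
  permutations of the set of triples modulo \<open>q\<close> that satisfy the relators of \<open>H\<close>; the resulting
  action shows that the exponents \<open>j\<close>, \<open>i\<close>, \<open>k\<close> are unique modulo \<open>q\<close> (\<open>nf_inj\<close>). From then on
  \<open>H\<close> is a group of triples with known multiplication.

  In these coordinates the centre is \<open>\<langle>C\<^sup>r\<rangle>\<close> with \<open>r = 2\<^sup>m\<^sup>-\<^sup>1\<close>, and the second centre consists of the
  triples for which \<open>2\<^sup>m\<close> divides \<open>j\<close> and \<open>i\<close> and \<open>2\<^sup>m\<^sup>-\<^sup>1\<close> divides \<open>k\<close> (\<open>mem_Z2_iff\<close>). It
  therefore has order \<open>2\<^sup>3\<^sup>m\<^sup>-\<^sup>2\<close>. It is abelian of exponent \<open>2\<^sup>m\<close>, commutes with \<open>C\<close>, and the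
  commutator of \<open>x \<in> Z\<^sub>2(H)\<close> with any element of \<open>H\<close> is the square of a central element of exponent
  dividing \<open>2\<^sup>m\<close> (\<open>Z2_commutator\<close>).

  These facts give \<open>(g x)\<^sup>n = g\<^sup>n\<close> when \<open>2\<^sup>m\<close> divides \<open>n\<close>, and \<open>(g x)\<^sup>n = g\<^sup>n x\<close> when it divides
  \<open>n - 1\<close> (\<open>int_pow_mult_Z2\<close>). Consequently \<open>A x\<close> and \<open>B y\<close> satisfy the relators of \<open>H\<close> for all
  \<open>x, y \<in> Z\<^sub>2(H)\<close>, and the endomorphism obtained from von Dyck's theorem fixes \<open>Z\<^sub>2(H)\<close> pointwise
  (\<open>Z2_endomorphism\<close>). Since the parameters lie in \<open>Z\<^sub>2(H)\<close>, composing two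
  such endomorphisms multiplies the parameters; so they are automorphisms and depend
  homomorphically on \<open>(x, y)\<close>.
  Conversely an automorphism is determined by the images of \<open>A\<close> and \<open>B\<close>, and if it is 2-central,
  these images are \<open>A x\<close> and \<open>B y\<close> with \<open>x, y \<in> Z\<^sub>2(H)\<close>. Hence \<open>Aut\<^sub>2(H)\<close> has
  \<open>|Z\<^sub>2(H)|\<^sup>2\<close> elements.
\<close>

section \<open>Coordinates and their shifts\<close>

type_synonym coords = "int \<times> int \<times> int"

text \<open>A triple \<open>(j, i, k)\<close> stands for the normal form \<open>B\<^sup>j A\<^sup>i C\<^sup>k\<close>. The three
  functions below describe right multiplication by \<open>A\<^sup>n\<close>, \<open>B\<^sup>n\<close> and \<open>C\<^sup>n\<close>, with exponents
  read modulo \<open>q = 2\<^sup>2\<^sup>m\<^sup>-\<^sup>1\<close>. The parameter is \<open>w = 2\<^sup>m\<^sup>-\<^sup>2 \<ell>\<close>, so that \<open>\<alpha> = 1 + 4 w\<close>: the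
  second-order terms of the collection process carry binomial coefficients, and measuring
  everything in units of \<open>w\<close> absorbs their denominators. Since \<open>8 w\<^sup>2 = q \<ell>\<^sup>2\<close> vanishes modulo
  \<open>q\<close>, all exponents are polynomials of degree one in \<open>w\<close>; in particular \<open>\<alpha>\<^sup>k\<close> may be
  replaced by \<open>1 + 4 k w\<close>. The terms of \<open>shiftB\<close> with the factor \<open>n (n - 1)\<close>
  vanish for \<open>n = 1\<close> and accumulate when this case is iterated.\<close>

fun shiftA :: "int \<Rightarrow> int \<Rightarrow> coords \<Rightarrow> coords" where
  "shiftA w n (j, i, k) = (j, i + n * (1 - 4 * k * w), k)"

fun shiftB :: "int \<Rightarrow> int \<Rightarrow> coords \<Rightarrow> coords" where
  "shiftB w n (j, i, k) =
    (j + n + 4 * n * k * w + 2 * n * (n - 1) * i * w,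
     i - 2 * n * w * i * (i - 1),
     k + 4 * n * i * k * w + n * i + n * (n - 1) * w * i * (i + 1))"

fun shiftC :: "int \<Rightarrow> coords \<Rightarrow> coords" where
  "shiftC n (j, i, k) = (j, i, k + n)"

fun reduce :: "int \<Rightarrow> coords \<Rightarrow> coords" where
  "reduce q (j, i, k) = (j mod q, i mod q, k mod q)"

locale modulus =
  fixes q w :: int
  assumes q_pos: "q > 0" and q_dvd: "q dvd 8 * w\<^sup>2"
begin

text \<open>The composite differs from the right-hand side by a polynomial all of whose terms contain
  \<open>w\<^sup>2\<close>. Its coefficients are divisible by 8 only because products of two consecutive integers
  are even; the halves \<open>r\<close>, \<open>r'\<close>, \<open>s\<close> of such products make the cofactor of \<open>8 w\<^sup>2\<close> explicit.\<close>

lemma shiftB_add: "reduce q (shiftB w p (shiftB w n t)) = reduce q (shiftB w (p + n) t)"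
proof -
  obtain j i k where t: "t = (j, i, k)" by (cases t)
  have "even (n * (n - 1))" "even (p * (p - 1))" "even (i * (i - 1))" by auto
  then obtain r r' s where r: "n * (n - 1) = 2 * r" and r': "p * (p - 1) = 2 * r'"
    and s: "i * (i - 1) = 2 * s" by (meson evenE)
  define k' where "k' = k + 4 * n * i * k * w + n * i + 2 * r * w * i * (i + 1)"
  have B: "shiftB w n t = (j + n + 4 * n * k * w + 4 * r * i * w, i - 4 * n * w * s, k')"
    unfolding t k'_def using r s by simp algebra
  have B': "shiftB w p (j', i', k'') = (j' + p + 4 * p * k'' * w + 4 * r' * i' * w,
     i' - 2 * p * w * i' * (i' - 1), k'' + 4 * p * i' * k'' * w + p * i' + 2 * r' * w * i' * (i' + 1))" for j' i' k''
    using r' by simp algebra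
  have np: "(p + n) * (p + n - 1) = 2 * (r + r' + n * p)" using r r' by (simp add: algebra_simps)
  have BB: "shiftB w (p + n) t = (j + (p + n) + 4 * (p + n) * k * w + 4 * (r + r' + n * p) * i * w,
     i - 4 * (p + n) * w * s,
     k + 4 * (p + n) * i * k * w + (p + n) * i + 2 * (r + r' + n * p) * w * i * (i + 1))"

    unfolding t using arg_cong[OF np, of "\<lambda>z. 2 * i * w * z"] arg_cong[OF np, of "\<lambda>z. w * i * (i + 1) * z"]
      arg_cong[OF s, of "\<lambda>z. 2 * (p + n) * w * z"] by (simp add: algebra_simps)
  have dvd: "q dvd d" if "d = 8 * w\<^sup>2 * x" for d x
    using that q_dvd dvd_mult2 by blast
  show ?thesis
    unfolding B B' BB reduce.simps prod.inject mod_eq_dvd_iff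
  proof (intro conjI, goal_cases)
    case 1
    show ?case
      by (rule dvd[where x = "2 * p * n * i * k + p * r * i * (i + 1) - 2 * r' * n * s"])
        (simp add: k'_def algebra_simps power2_eq_square)
  next
    case 2
    show ?case
      by (rule dvd[where x = "p * n * s * (2 * i - 1) - 4 * p * n\<^sup>2 * w * s\<^sup>2"])
        (use arg_cong[OF s, of "\<lambda>z. 2 * p * w * z"] in \<open>simp add: algebra_simps power2_eq_square\<close>)
  next
    case 3
    show ?case
      by (rule dvd[where x = "2 * p * n * i\<^sup>2 * k - 2 * p * n * s * k' + p * r * i\<^sup>2 * (i + 1)
            - r' * n * s * (2 * i + 1) + 4 * r' * n\<^sup>2 * w * s\<^sup>2"])
        (use arg_cong[OF s, of "\<lambda>z. 2 * p * n * w * z"]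
          in \<open>simp add: k'_def algebra_simps power2_eq_square\<close>)
  qed
qed

lemma shiftA_add: "shiftA w p (shiftA w n t) = shiftA w (p + n) t"
  by (cases t) (simp add: algebra_simps)

lemma shiftC_add: "shiftC p (shiftC n t) = shiftC (p + n) t"
  by (cases t) simp

lemma shift_0: "shiftA w 0 t = t" "shiftB w 0 t = t" "shiftC 0 t = t"
  by (cases t; simp)+

lemma reduce_reduce: "reduce q (reduce q t) = reduce q t"
  by (cases t) simp

lemma shift_reduce:
  "reduce q (shiftA w n (reduce q t)) = reduce q (shiftA w n t)"
  "reduce q (shiftB w n (reduce q t)) = reduce q (shiftB w n t)"
  "reduce q (shiftC n (reduce q t)) = reduce q (shiftC n t)"
  by (cases t; simp; intro conjI mod_add_cong mod_mult_cong mod_diff_cong mod_mod_trivial refl)+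

lemma shift_period:
  assumes "q dvd n"
  shows "reduce q (shiftA w n t) = reduce q t"
    and "reduce q (shiftB w n t) = reduce q t"
  using assms by (cases t; auto simp: mod_eq_dvd_iff mult.assoc elim!: dvdE)+

text \<open>The next three lemmas are the defining relations \<open>A B = B A C\<close>, \<open>A C = C A\<^sup>\<alpha>\<close> and
  \<open>C B = B\<^sup>\<alpha> C\<close> read as identities between right multiplications, so that the letters act in the
  opposite order.\<close>

lemma shiftA_shiftB: "reduce q (shiftB w 1 (shiftA w 1 t)) =
   reduce q (shiftC 1 (shiftA w 1 (shiftB w 1 t)))"
proof -
  obtain j i k where t: "t = (j, i, k)" by (cases t)
  have dvd: "q dvd d" if "d = 8 * w\<^sup>2 * x" for d x
    using that q_dvd dvd_mult2 by blast
  show ?thesis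
    unfolding t shiftA.simps shiftB.simps shiftC.simps reduce.simps prod.inject mod_eq_dvd_iff
  proof (intro conjI, goal_cases)
    case 2
    show ?case
      by (rule dvd[where x = "k + 4 * i * k - 4 * k\<^sup>2 * w"]) (simp add: algebra_simps power2_eq_square)
  next
    case 3
    show ?case
      by (rule dvd[where x = "- 2 * k\<^sup>2"]) (simp add: algebra_simps power2_eq_square)
  qed simp
qed

lemma shiftA_shiftC: "reduce q (shiftC 1 (shiftA w 1 t)) =
   reduce q (shiftA w (1 + 4 * w) (shiftC 1 t))"
proof -
  obtain j i k where t: "t = (j, i, k)" by (cases t)
  have dvd: "q dvd d" if "d = 8 * w\<^sup>2 * x" for d x
    using that q_dvd dvd_mult2 by blast
  have "q dvd (i + (1 - 4 * k * w)) - (i + (1 + 4 * w) * (1 - 4 * (k + 1) * w))"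
    by (rule dvd[where x = "2 * (k + 1)"]) (simp add: algebra_simps power2_eq_square)
  then show ?thesis
    unfolding t shiftA.simps shiftB.simps shiftC.simps reduce.simps prod.inject mod_eq_dvd_iff by simp
qed

lemma shiftC_shiftB: "reduce q (shiftB w 1 (shiftC 1 t)) =
   reduce q (shiftC 1 (shiftB w (1 + 4 * w) t))"
proof -
  obtain j i k where t: "t = (j, i, k)" by (cases t)
  have "even (i * (i + 1))" by auto
  then obtain s where s: "i * (i + 1) = 2 * s" by (meson evenE)
  have dvd: "q dvd d" if "d = 8 * w\<^sup>2 * x" for d x
    using that q_dvd dvd_mult2 by blast
  show ?thesis
    unfolding t shiftA.simps shiftB.simps shiftC.simps reduce.simps prod.inject mod_eq_dvd_iff
  proof (intro conjI, goal_cases)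
    case 1
    show ?case
      by (rule dvd[where x = "- 2 * k - i - 4 * i * w"]) (simp add: algebra_simps power2_eq_square)
  next
    case 2
    show ?case
      by (rule dvd[where x = "i * (i - 1)"]) (simp add: algebra_simps power2_eq_square)
  next
    case 3
    show ?case
      by (rule dvd[where x = "- 2 * i * k - s - 4 * w * s"])
        (use arg_cong[OF s, of "\<lambda>z. 4 * w * w * (1 + 4 * w) * z"]
          in \<open>simp add: algebra_simps power2_eq_square\<close>)
  qed
qed
end

section \<open>Upper central series, central automorphisms and presentations\<close>

lemma (in group_hom) normal_preimage:
  assumes "K \<lhd> H"
  shows "{x \<in> carrier G. h x \<in> K} \<lhd> G"
proof -
  interpret K: normal K H by (rule assms)
  have "subgroup {x \<in> carrier G. h x \<in> K} G"
    by (rule G.subgroupI) (auto intro!: exI[of _ "\<one>"])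
  then show ?thesis
    using K.inv_op_closed2 by (auto simp: G.normal_inv_iff)
qed

context group
begin

text \<open>Laws for integer powers reduce to one multiplication step: a closed formula for \<open>g\<^sup>n\<close> only has to
  be checked at 0 and under right multiplication by \<open>g\<close>.\<close>

lemma int_pow_unique:
  fixes f :: "int \<Rightarrow> 'a"
  assumes f: "\<And>n. f n \<in> carrier G" and g: "g \<in> carrier G"
    and zero: "f 0 = \<one>" and Suc: "\<And>n. f (n + 1) = f n \<otimes> g"
  shows "f n = g [^] n"
proof (induction n rule: int_induct[of _ 0])
  case (step1 i)
  then show ?case using g by (simp add: Suc int_pow_mult)
next
  case (step2 i)
  have "f (i - 1) \<otimes> g = g [^] (i - 1) \<otimes> g"
    using Suc[of "i - 1"] step2 g int_pow_mult[of g "i - 1" 1] by simp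
  then show ?case using f g by simp
qed (simp add: zero)

lemma int_pow_mod_eq:
  assumes g: "g \<in> carrier G" and q: "g [^] q = \<one>" and ij: "i mod q = j mod (q :: int)"
  shows "g [^] i = g [^] j"
proof -
  obtain k where "i = j + q * k"
    using ij by (metis add.commute diff_add_cancel dvdE mod_eq_dvd_iff)
  then show ?thesis using g q by (simp add: int_pow_mult int_pow_pow[symmetric])
qed

lemma center_normal: "center G \<lhd> G"
proof -
  have comm: "z \<otimes> g = g \<otimes> z" if "z \<in> center G" "g \<in> carrier G" for z g
    using that by (simp only: center_def mem_Collect_eq)
  have carr: "z \<in> carrier G" if "z \<in> center G" for z
    using that by (simp only: center_def mem_Collect_eq)
  have "subgroup (center G) G"
  proof (rule subgroupI)
    show "inv z \<in> center G" if z: "z \<in> center G" for z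
    proof -
      have "inv z \<otimes> g = g \<otimes> inv z" if g: "g \<in> carrier G" for g
      proof -
        have "z \<otimes> (g \<otimes> inv z) = g \<otimes> z \<otimes> inv z"
          using carr[OF z] g by (simp add: comm[OF z g, symmetric] m_assoc)
        then show ?thesis using carr[OF z] g by (simp add: inv_solve_left' m_assoc)
      qed
      then show ?thesis using carr[OF z] by (simp add: center_def)
    qed
    show "x \<otimes> y \<in> center G" if x: "x \<in> center G" and y: "y \<in> center G" for x y
    proof -
      have "x \<otimes> y \<otimes> g = g \<otimes> (x \<otimes> y)" if g: "g \<in> carrier G" for g
        using carr[OF x] carr[OF y] g comm[OF x g] comm[OF y g] by (metis m_assoc)
      then show ?thesis using carr[OF x] carr[OF y] by (simp add: center_def)
    qed
  qed (auto simp: center_def)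
  moreover have "x \<otimes> z \<otimes> inv x \<in> center G" if x: "x \<in> carrier G" and z: "z \<in> center G" for x z
  proof -
    have "x \<otimes> z \<otimes> inv x = z"
      using x carr[OF z] by (simp add: inv_solve_right' comm[OF z x])
    then show ?thesis using z by (simp only:)
  qed
  ultimately show ?thesis by (simp add: normal_inv_iff)
qed

text \<open>Each step of the upper central series is the preimage of the centre of a quotient.\<close>

lemma upper_central_normal: "upper_central G i \<lhd> G"
proof (induction i)
  case 0
  show ?case by (simp add: one_is_normal)
next
  case (Suc i)
  interpret N: normal "upper_central G i" G by (rule Suc)
  interpret Q: group "G Mod upper_central G i" by (rule N.factorgroup_is_group)
  interpret group_hom G "G Mod upper_central G i" "\<lambda>x. upper_central G i #> x"
    by unfold_locales (rule N.r_coset_hom_Mod)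
  show ?case using normal_preimage[OF Q.center_normal] by simp
qed

lemma upper_central_Suc:
  "upper_central G (Suc i) =
    {x \<in> carrier G. \<forall>g\<in>carrier G. x \<otimes> g \<in> upper_central G i #> (g \<otimes> x)}"
proof -
  interpret N: normal "upper_central G i" G by (rule upper_central_normal)
  have eq: "upper_central G i #> a = upper_central G i #> b \<longleftrightarrow> a \<in> upper_central G i #> b"
    if "a \<in> carrier G" "b \<in> carrier G" for a b
    using that repr_independence[OF _ _ N.subgroup_axioms] rcos_self[OF _ N.subgroup_axioms] by metis
  have "upper_central G i #> x \<in> center (G Mod upper_central G i) \<longleftrightarrow>
      (\<forall>g\<in>carrier G. x \<otimes> g \<in> upper_central G i #> (g \<otimes> x))" if x: "x \<in> carrier G" for x
  proof -
    have "upper_central G i #> x \<in> center (G Mod upper_central G i) \<longleftrightarrow>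
      (\<forall>g\<in>carrier G. upper_central G i #> (x \<otimes> g) = upper_central G i #> (g \<otimes> x))"
      using x by (auto simp: center_def FactGroup_def RCOSETS_def N.rcos_sum)
    then show ?thesis using eq x by simp
  qed
  then show ?thesis by auto
qed

lemma upper_central_1: "upper_central G (Suc 0) = center G"
  by (auto simp: upper_central_Suc r_coset_def center_def simp del: upper_central.simps(2))

lemma upper_central_2:
  "upper_central G 2 =
    {x \<in> carrier G. \<forall>g\<in>carrier G. \<exists>z\<in>center G. x \<otimes> g = z \<otimes> (g \<otimes> x)}"
  unfolding numeral_2_eq_2 upper_central_Suc[of "Suc 0"] upper_central_1
  by (auto simp: r_coset_def)

end

text \<open>An automorphism that moves every element inside its own coset maps every coset onto itself and
  not merely into itself: by surjectivity a coset member is some \<open>\<sigma> h\<close>, and then \<open>h\<close> lies in the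
  same coset.\<close>

lemma (in group) central_autos_iff:
  "\<sigma> \<in> central_autos G i \<longleftrightarrow>
    \<sigma> \<in> auto G \<and> (\<forall>g\<in>carrier G. \<sigma> g \<in> upper_central G i #> g)"
proof -
  interpret N: normal "upper_central G i" G by (rule upper_central_normal)
  let ?N = "upper_central G i"
  have coset: "\<sigma> ` (?N #> g) = ?N #> g"
    if \<sigma>: "\<sigma> \<in> auto G" "\<And>g. g \<in> carrier G \<Longrightarrow> \<sigma> g \<in> ?N #> g" and g: "g \<in> carrier G" for g
  proof
    have sub: "?N #> g \<subseteq> carrier G" using g N.subset r_coset_subset_G by simp
    have eq: "?N #> \<sigma> h = ?N #> h" if "h \<in> carrier G" for h
      using repr_independence[OF \<sigma>(2) _ N.subgroup_axioms] that by simp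
    show "\<sigma> ` (?N #> g) \<subseteq> ?N #> g"
    proof
      fix y assume "y \<in> \<sigma> ` (?N #> g)"
      then obtain h where h: "h \<in> ?N #> g" "y = \<sigma> h" by blast
      then show "y \<in> ?N #> g"
        using \<sigma>(2)[of h] sub repr_independence[OF h(1) g N.subgroup_axioms] by auto
    qed
    show "?N #> g \<subseteq> \<sigma> ` (?N #> g)"
    proof
      fix y assume y: "y \<in> ?N #> g"
      have "\<sigma> ` carrier G = carrier G" using \<sigma>(1) by (simp add: auto_def Bij_def bij_betw_def)
      then obtain h where h: "h \<in> carrier G" "y = \<sigma> h" using y sub by blast
      have "?N #> g = ?N #> h"
        using repr_independence[OF y g N.subgroup_axioms] eq h by simp
      then show "y \<in> \<sigma> ` (?N #> g)" using h rcos_self[OF h(1) N.subgroup_axioms] by blast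
    qed
  qed
  have "(\<forall>C\<in>carrier (G Mod ?N). \<sigma> ` C = C) \<longleftrightarrow> (\<forall>g\<in>carrier G. \<sigma> g \<in> ?N #> g)" if "\<sigma> \<in> auto G"
  proof
    assume C: "\<forall>C\<in>carrier (G Mod ?N). \<sigma> ` C = C"
    show "\<forall>g\<in>carrier G. \<sigma> g \<in> ?N #> g"
    proof
      fix g assume g: "g \<in> carrier G"
      have "\<sigma> ` (?N #> g) = ?N #> g" using C g by (auto simp: FactGroup_def RCOSETS_def)
      then show "\<sigma> g \<in> ?N #> g" using rcos_self[OF g N.subgroup_axioms] by blast
    qed
  next
    assume "\<forall>g\<in>carrier G. \<sigma> g \<in> ?N #> g"
    then show "\<forall>C\<in>carrier (G Mod ?N). \<sigma> ` C = C"
      using coset[OF that] by (auto simp: FactGroup_def RCOSETS_def)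
  qed
  moreover have "induced_auto G ?N \<sigma> = \<one>\<^bsub>AutoGroup (G Mod ?N)\<^esub> \<longleftrightarrow> (\<forall>C\<in>carrier (G Mod ?N). \<sigma> ` C = C)"
    by (auto simp: induced_auto_def AutoGroup_def BijGroup_def fun_eq_iff restrict_def)
  ultimately show ?thesis
    by (auto simp: central_autos_def kernel_def AutoGroup_def)
qed

lemma (in group) eval_word_unique:
  fixes \<phi> :: "'g fword set \<Rightarrow> 'a"
  assumes \<phi>: "\<phi> \<in> hom free_group G"
  shows "\<phi> (word_class u) = eval_word G (\<lambda>g. \<phi> (free_gen g)) u"
proof -
  interpret F: group "free_group :: 'g fword set monoid" by (rule group_free_group)
  interpret \<phi>: group_hom "free_group :: 'g fword set monoid" G \<phi> by unfold_locales (rule \<phi>)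
  have gen: "free_gen g \<in> carrier free_group" for g :: 'g
    by (simp add: free_gen_def free_group_carrier)
  have inv: "word_class [(g, False)] = inv\<^bsub>free_group\<^esub> free_gen g" for g :: 'g
    by (rule F.inv_equality[symmetric])
      (use word_eq.cancel[of "[]" g False "[]"] in
        \<open>auto simp: free_gen_def free_group_mult free_group_one free_group_carrier word_class_eq_iff\<close>)
  show ?thesis
  proof (induction u)
    case (Cons a u)
    obtain g b where a: "a = (g, b)" by force
    have "word_class (a # u) = word_class [(g, b)] \<otimes>\<^bsub>free_group\<^esub> word_class u"
      by (simp add: free_group_mult a)
    moreover have "word_class [(g, b)] = (if b then free_gen g else inv\<^bsub>free_group\<^esub> free_gen g)"
      by (simp add: inv) (simp add: free_gen_def)
    moreover have "word_class u \<in> carrier free_group" by (simp add: free_group_carrier)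
    ultimately show ?case
      using Cons gen by (simp add: a)
  qed (use \<phi>.hom_one in \<open>simp add: free_group_one\<close>)
qed

lemma has_presentation_generated:
  assumes "has_presentation G f R" and x: "x \<in> carrier G"
  obtains u where "x = eval_word G f u"
proof -
  from assms obtain \<phi> where G: "group G" and \<phi>: "\<phi> \<in> hom free_group G"
      "\<And>g. \<phi> (free_gen g) = f g" "\<phi> ` carrier free_group = carrier G"
    by (auto simp: has_presentation_def)
  then obtain u where "x = \<phi> (word_class u)" using x by (auto simp: free_group_carrier)
  then show thesis using that group.eval_word_unique[OF G \<phi>(1)] \<phi>(2) by simp
qed

text \<open>Von Dyck's theorem. The kernel of the map onto \<open>H\<close> is the normal closure of the relators, and
  this is contained in the kernel of \<open>\<phi>\<close>, so \<open>\<phi>\<close> factors through \<open>H\<close>.\<close>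

lemma has_presentation_extend:
  assumes pres: "has_presentation H f R" and R: "R \<subseteq> carrier free_group"
    and G: "group G" and \<phi>: "\<phi> \<in> hom free_group G" "\<And>r. r \<in> R \<Longrightarrow> \<phi> r = \<one>\<^bsub>G\<^esub>"
  obtains \<psi> where "\<psi> \<in> hom H G" "\<And>g. \<psi> (f g) = \<phi> (free_gen g)"
proof -
  from pres obtain \<pi> where H: "group H" and \<pi>: "\<pi> \<in> hom free_group H"
      "\<And>g. \<pi> (free_gen g) = f g" "\<pi> ` carrier free_group = carrier H"
      "kernel free_group H \<pi> = normal_closure free_group R"
    by (auto simp: has_presentation_def)
  interpret F: group free_group by (rule group_free_group)
  interpret H: group H by (rule H)
  interpret G: group G by (rule G)
  interpret \<pi>: group_hom free_group H \<pi> by unfold_locales (rule \<pi>)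
  interpret \<phi>: group_hom free_group G \<phi> by unfold_locales (rule \<phi>)
  have "normal_closure free_group R \<subseteq> kernel free_group G \<phi>"
    unfolding normal_closure_def
    by (rule F.generate_subgroup_incl[OF _ \<phi>.subgroup_kernel])
      (use R \<phi>(2) in \<open>auto simp: kernel_def subset_iff\<close>)
  then have ker: "\<phi> x = \<one>\<^bsub>G\<^esub>" if "x \<in> carrier free_group" "\<pi> x = \<one>\<^bsub>H\<^esub>" for x
    using that \<pi>(4) by (auto simp: kernel_def)
  define \<psi> where "\<psi> h = \<phi> (SOME x. x \<in> carrier free_group \<and> \<pi> x = h)" for h
  have \<psi>: "\<psi> (\<pi> x) = \<phi> x" if x: "x \<in> carrier free_group" for x
  proof -
    define y where "y = (SOME y. y \<in> carrier free_group \<and> \<pi> y = \<pi> x)"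
    have y: "y \<in> carrier free_group \<and> \<pi> y = \<pi> x"
      unfolding y_def by (rule someI[of _ x]) (use x in simp)
    then have "\<phi> (y \<otimes>\<^bsub>free_group\<^esub> inv\<^bsub>free_group\<^esub> x) = \<one>\<^bsub>G\<^esub>"
      using x by (intro ker) auto
    then have "\<phi> y = \<phi> x"
      using x y G.inv_solve_right'[of "\<one>\<^bsub>G\<^esub>" "\<phi> y" "\<phi> x"] by simp
    then show ?thesis by (simp add: \<psi>_def y_def)
  qed
  have "\<psi> \<in> hom H G"
    unfolding \<pi>(3)[symmetric] by (rule homI) (auto simp flip: \<pi>(3) simp: \<psi> simp flip: \<pi>.hom_mult)
  moreover have "\<psi> (f g) = \<phi> (free_gen g)" for g
    using \<psi>[of "free_gen g"] \<pi>(2) by (simp add: free_gen_def free_group_carrier)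
  ultimately show thesis using that by blast
qed

section \<open>The relations, and a permutation model\<close>

definition H_relations :: "('a, 'b) monoid_scheme \<Rightarrow> nat \<Rightarrow> int \<Rightarrow> 'a \<Rightarrow> 'a \<Rightarrow> bool" where
  "H_relations G m l a b \<longleftrightarrow>
    conjugate G a (commutator G a b) = a [^]\<^bsub>G\<^esub> (1 + 2 ^ m * l) \<and>
    conjugate G b (commutator G b a) = b [^]\<^bsub>G\<^esub> (1 + 2 ^ m * l) \<and>
    a [^]\<^bsub>G\<^esub> ((2::nat) ^ (2 * m - 1)) = \<one>\<^bsub>G\<^esub> \<and> b [^]\<^bsub>G\<^esub> ((2::nat) ^ (2 * m - 1)) = \<one>\<^bsub>G\<^esub>"

lemma H_relators_trivial_iff:
  assumes G: "group G" and \<phi>: "\<phi> \<in> hom free_group G"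
  shows "(\<forall>r\<in>H_relators m l. \<phi> r = \<one>\<^bsub>G\<^esub>) \<longleftrightarrow> H_relations G m l (\<phi> (free_gen GenA)) (\<phi> (free_gen GenB))"
proof -
  interpret G: group G by (rule G)
  interpret F: group "free_group :: gen fword set monoid" by (rule group_free_group)
  interpret \<phi>: group_hom "free_group :: gen fword set monoid" G \<phi> by unfold_locales (rule \<phi>)
  have gen: "free_gen g \<in> carrier free_group" for g :: gen
    by (simp add: free_gen_def free_group_carrier)
  show ?thesis
    by (simp add: H_relators_def Let_def H_relations_def conjugate_def commutator_def gen
      \<phi>.hom_int_pow \<phi>.hom_nat_pow G.inv_solve_right')
qed

context group
begin

text \<open>With a name for the commutator the relations become rewriting rules between words of length
  at most three.\<close>

lemma H_relationsI:
  assumes abc: "a \<in> carrier G" "b \<in> carrier G" "c \<in> carrier G"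
    and "a \<otimes> b = b \<otimes> a \<otimes> c"
    and "a \<otimes> c = c \<otimes> a [^] (1 + 2 ^ m * l)" and "c \<otimes> b = b [^] (1 + 2 ^ m * l) \<otimes> c"
    and "a [^] ((2::nat) ^ (2 * m - 1)) = \<one>" and "b [^] ((2::nat) ^ (2 * m - 1)) = \<one>"
  shows "H_relations G m l a b" and "commutator G a b = c"
proof -
  show c: "commutator G a b = c"
    using assms(1-4) by (simp add: commutator_def m_assoc inv_solve_left')
  have "commutator G b a = inv (commutator G a b)"
    using abc by (simp add: commutator_def inv_mult_group m_assoc)
  then show "H_relations G m l a b"
    using assms by (simp add: H_relations_def c conjugate_def m_assoc inv_solve_left' inv_solve_right')
qed

lemma H_relationsD:
  assumes ab: "a \<in> carrier G" "b \<in> carrier G" and pair: "H_relations G m l a b"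
  defines "c \<equiv> commutator G a b"
  shows "c \<in> carrier G" and "a \<otimes> b = b \<otimes> a \<otimes> c"
    and "a \<otimes> c = c \<otimes> a [^] (1 + 2 ^ m * l)" and "c \<otimes> b = b [^] (1 + 2 ^ m * l) \<otimes> c"
    and "a [^] ((2::nat) ^ (2 * m - 1)) = \<one>" and "b [^] ((2::nat) ^ (2 * m - 1)) = \<one>"
proof -
  show c: "c \<in> carrier G" using ab by (simp add: c_def commutator_def)
  show "a \<otimes> b = b \<otimes> a \<otimes> c"
    using ab by (simp add: c_def commutator_def m_assoc flip: inv_solve_left')
  have "commutator G b a = inv c"
    using ab by (simp add: c_def commutator_def inv_mult_group m_assoc)
  then have conj: "inv c \<otimes> (a \<otimes> c) = a [^] (1 + 2 ^ m * l)" "c \<otimes> b \<otimes> inv c = b [^] (1 + 2 ^ m * l)"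
    using pair ab c by (simp_all add: H_relations_def conjugate_def m_assoc flip: c_def)
  show "a \<otimes> c = c \<otimes> a [^] (1 + 2 ^ m * l)"
    using conj(1) ab c by (simp add: inv_solve_left')
  show "c \<otimes> b = b [^] (1 + 2 ^ m * l) \<otimes> c"
    using conj(2) ab c by (simp add: inv_solve_right')
  show "a [^] ((2::nat) ^ (2 * m - 1)) = \<one>" and "b [^] ((2::nat) ^ (2 * m - 1)) = \<one>"
    using pair by (simp_all add: H_relations_def)
qed

text \<open>Permutations compose in the order opposite to the right multiplications that they describe.
  Passing to inverses repairs this, so the relations are assumed here in reversed form.\<close>

lemma H_relations_inv:
  assumes abc: "a \<in> carrier G" "b \<in> carrier G" "c \<in> carrier G"
    and r1: "b \<otimes> a = c \<otimes> a \<otimes> b"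
    and r2: "c \<otimes> a = a [^] (1 + 2 ^ m * l) \<otimes> c" and r3: "b \<otimes> c = c \<otimes> b [^] (1 + 2 ^ m * l)"
    and pow: "a [^] ((2::nat) ^ (2 * m - 1)) = \<one>" "b [^] ((2::nat) ^ (2 * m - 1)) = \<one>"
  shows "H_relations G m l (inv a) (inv b)" and "commutator G (inv a) (inv b) = inv c"
proof -
  have "inv a \<otimes> inv b = inv b \<otimes> inv a \<otimes> inv c"
    using abc r1 by (simp add: inv_mult_group[symmetric] m_assoc)
  moreover have "inv a \<otimes> inv c = inv c \<otimes> inv a [^] (1 + 2 ^ m * l)"
    using abc r2 by (simp add: inv_mult_group[symmetric] int_pow_inv)
  moreover have "inv c \<otimes> inv b = inv b [^] (1 + 2 ^ m * l) \<otimes> inv c"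
    using abc r3 by (simp add: inv_mult_group[symmetric] int_pow_inv)
  ultimately show "H_relations G m l (inv a) (inv b)" "commutator G (inv a) (inv b) = inv c"
    using abc pow H_relationsI[of "inv a" "inv b" "inv c"] by (simp_all add: nat_pow_inv)
qed

end

context modulus
begin

definition residues :: "coords set" where
  "residues = {t. reduce q t = t}"

definition residue_map :: "(coords \<Rightarrow> coords) \<Rightarrow> coords \<Rightarrow> coords" where
  "residue_map f = (\<lambda>t\<in>residues. reduce q (f t))"

lemma residue_map_compose:
  assumes "\<And>t. reduce q (f (reduce q t)) = reduce q (f t)"
  shows "compose residues (residue_map f) (residue_map g) = residue_map (f \<circ> g)"
  using assms by (auto simp: compose_def residue_map_def residues_def reduce_reduce fun_eq_iff)

lemma residue_map_cong:
  "(\<And>t. reduce q (f t) = reduce q (g t)) \<Longrightarrow> residue_map f = residue_map g"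
  by (auto simp: residue_map_def)

lemma residue_map_Bij:
  assumes f: "\<And>t. reduce q (f (reduce q t)) = reduce q (f t)"
    and g: "\<And>t. reduce q (g (reduce q t)) = reduce q (g t)"
    and gf: "\<And>t. reduce q (g (f t)) = reduce q t" and fg: "\<And>t. reduce q (f (g t)) = reduce q t"
  shows "residue_map f \<in> Bij residues"
proof -
  have "bij_betw (residue_map f) residues residues"
    by (rule bij_betw_byWitness[where f' = "residue_map g"])
      (use f g gf fg in \<open>auto simp: residue_map_def residues_def reduce_reduce\<close>)
  then show ?thesis by (simp add: Bij_def residue_map_def)
qed

lemma shift_Bij:
  "residue_map (shiftA w n) \<in> Bij residues"
  "residue_map (shiftB w n) \<in> Bij residues"
  "residue_map (shiftC n) \<in> Bij residues"
  by (rule residue_map_Bij[where g = "shiftA w (- n)"] residue_map_Bij[where g = "shiftB w (- n)"]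
      residue_map_Bij[where g = "shiftC (- n)"];
      simp add: shift_reduce shiftA_add shiftB_add shiftC_add shift_0)+

lemma residue_map_mult:
  assumes "residue_map f \<in> Bij residues" "residue_map g \<in> Bij residues"
    "\<And>t. reduce q (f (reduce q t)) = reduce q (f t)"
  shows "residue_map f \<otimes>\<^bsub>BijGroup residues\<^esub> residue_map g = residue_map (f \<circ> g)"
  using assms by (simp add: BijGroup_def residue_map_compose)

lemma shift_pow:
  defines "S \<equiv> BijGroup residues"
  shows "residue_map (shiftA w n) = residue_map (shiftA w 1) [^]\<^bsub>S\<^esub> n"
    and "residue_map (shiftB w n) = residue_map (shiftB w 1) [^]\<^bsub>S\<^esub> n"
    and "residue_map (shiftC n) = residue_map (shiftC 1) [^]\<^bsub>S\<^esub> n"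
proof -
  interpret S: group S unfolding S_def by (rule group_BijGroup)
  have 0: "residue_map f = \<one>\<^bsub>S\<^esub>" if "\<And>t. f t = t" for f
    using that by (auto simp: S_def BijGroup_def residue_map_def residues_def)
  note mult = residue_map_mult[folded S_def]
  show "residue_map (shiftA w n) = residue_map (shiftA w 1) [^]\<^bsub>S\<^esub> n"
    by (rule S.int_pow_unique)
      (auto simp: mult shift_Bij shift_reduce 0 shift_0 shiftA_add add.commute
        simp del: shiftA.simps intro!: residue_map_cong, simp_all add: S_def BijGroup_def shift_Bij)
  show "residue_map (shiftB w n) = residue_map (shiftB w 1) [^]\<^bsub>S\<^esub> n"
    by (rule S.int_pow_unique)
      (auto simp: mult shift_Bij shift_reduce 0 shift_0 shiftB_add add.commute
        simp del: shiftB.simps intro!: residue_map_cong, simp_all add: S_def BijGroup_def shift_Bij)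
  show "residue_map (shiftC n) = residue_map (shiftC 1) [^]\<^bsub>S\<^esub> n"
    by (rule S.int_pow_unique)
      (auto simp: mult shift_Bij shift_reduce 0 shift_0 shiftC_add add.commute
        simp del: shiftC.simps intro!: residue_map_cong, simp_all add: S_def BijGroup_def shift_Bij)
qed

end

section \<open>Powers and conjugation\<close>

context group
begin

text \<open>Conjugation commutes with powers; this form avoids inverses.\<close>

lemma int_pow_intertwine:
  assumes "g \<in> carrier G" "x \<in> carrier G" "y \<in> carrier G" and gx: "g \<otimes> x = y \<otimes> g"
  shows "g \<otimes> x [^] n = y [^] (n :: int) \<otimes> g"
proof -
  have "inv g \<otimes> y [^] n \<otimes> g = x [^] n"
  proof (rule int_pow_unique)
    fix n :: int
    have x: "x = inv g \<otimes> y \<otimes> g" using assms by (simp add: m_assoc inv_solve_left flip: gx)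
    have "inv g \<otimes> y [^] (n + 1) \<otimes> g = inv g \<otimes> y [^] n \<otimes> (g \<otimes> inv g) \<otimes> y \<otimes> g"
      using assms(1-3) by (simp add: int_pow_mult m_assoc)
    also have "\<dots> = inv g \<otimes> y [^] n \<otimes> g \<otimes> x"
      unfolding x using assms(1-3) by (simp only: m_assoc m_closed inv_closed int_pow_closed)
    finally show "inv g \<otimes> y [^] (n + 1) \<otimes> g = inv g \<otimes> y [^] n \<otimes> g \<otimes> x" .
  qed (use assms in auto)
  then have "g \<otimes> x [^] n = g \<otimes> (inv g \<otimes> (y [^] n \<otimes> g))"
    using assms by (simp add: m_assoc)
  then show ?thesis using assms by (simp add: m_assoc[symmetric])
qed

text \<open>If conjugation by \<open>g\<close> raises \<open>x\<close> to the power \<open>1 + e\<close>, then conjugation by \<open>g\<^sup>k\<close> raises it to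
  \<open>(1 + e)\<^sup>k\<close>, which is \<open>1 + k e\<close> modulo \<open>q\<close> because \<open>q\<close> divides \<open>e\<^sup>2\<close>. For negative
  \<open>k\<close> the inverse of \<open>1 + e\<close> is \<open>1 - e\<close>.\<close>

lemma power_conjugation:
  assumes g: "g \<in> carrier G" and x: "x \<in> carrier G" and xq: "x [^] (q :: int) = \<one>"
    and qe: "q dvd e\<^sup>2" and gx: "g \<otimes> x = x [^] (1 + e) \<otimes> g"
  shows "g [^] (k :: int) \<otimes> x [^] n = x [^] (n * (1 + k * e)) \<otimes> g [^] k"
proof (induction k arbitrary: n rule: int_induct[of _ 0])
  case (step1 k)
  have gx': "g \<otimes> x [^] n = x [^] (n * (1 + e)) \<otimes> g"
    using int_pow_intertwine[OF g x _ gx] x by (simp add: int_pow_pow mult.commute)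
  have "g [^] (k + 1) \<otimes> x [^] n = g [^] k \<otimes> x [^] (n * (1 + e)) \<otimes> g"
    using g x by (simp add: int_pow_mult m_assoc gx')
  also have "\<dots> = x [^] (n * (1 + e) * (1 + k * e)) \<otimes> g [^] (k + 1)"
    using g x by (simp add: step1 int_pow_mult m_assoc)
  also have "x [^] (n * (1 + e) * (1 + k * e)) = x [^] (n * (1 + (k + 1) * e))"
  proof (rule int_pow_mod_eq[OF x xq], unfold mod_eq_dvd_iff)
    have "n * (1 + e) * (1 + k * e) - n * (1 + (k + 1) * e) = e\<^sup>2 * (n * k)"
      by (simp add: algebra_simps power2_eq_square)
    then show "q dvd n * (1 + e) * (1 + k * e) - n * (1 + (k + 1) * e)" using qe by simp
  qed
  finally show ?case .
next
  case (step2 k)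
  have "x [^] n = x [^] (n * (1 - e) * (1 + e))"
  proof (rule int_pow_mod_eq[OF x xq], unfold mod_eq_dvd_iff)
    have "n - n * (1 - e) * (1 + e) = e\<^sup>2 * n"
      by (simp add: algebra_simps power2_eq_square)
    then show "q dvd n - n * (1 - e) * (1 + e)" using qe by simp
  qed
  also have "\<dots> = g \<otimes> x [^] (n * (1 - e)) \<otimes> inv g"
    using int_pow_intertwine[OF g x _ gx, of "n * (1 - e)"] x g
    by (simp add: int_pow_pow mult.commute inv_solve_right)
  finally have xn: "x [^] n = g \<otimes> x [^] (n * (1 - e)) \<otimes> inv g" .
  have "g [^] (k - 1) \<otimes> x [^] n = g [^] (k - 1) \<otimes> g \<otimes> x [^] (n * (1 - e)) \<otimes> inv g"
    unfolding xn using g x by (simp add: m_assoc)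
  also have "g [^] (k - 1) \<otimes> g = g [^] k"
    using g int_pow_mult[of g "k - 1" 1] by simp
  also have "g [^] k \<otimes> x [^] (n * (1 - e)) \<otimes> inv g = x [^] (n * (1 - e) * (1 + k * e)) \<otimes> g [^] (k - 1)"
    using g x step2 by (simp add: m_assoc int_pow_diff)
  also have "x [^] (n * (1 - e) * (1 + k * e)) = x [^] (n * (1 + (k - 1) * e))"
  proof (rule int_pow_mod_eq[OF x xq], unfold mod_eq_dvd_iff)
    have "n * (1 - e) * (1 + k * e) - n * (1 + (k - 1) * e) = e\<^sup>2 * (- n * k)"
      by (simp add: algebra_simps power2_eq_square)
    then show "q dvd n * (1 - e) * (1 + k * e) - n * (1 + (k - 1) * e)" using qe by (simp only: dvd_mult2)
  qed
  finally show ?case .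
qed (use x in simp)

text \<open>Collecting the powers of \<open>x\<close> in \<open>(x g)\<^sup>i\<close> gives the exponent
  \<open>\<Sum>\<^sub>k\<^sub><\<^sub>i (1 - 4 k w) = i - 2 w i (i - 1)\<close>.\<close>

lemma int_pow_mult_twisted:
  assumes g: "g \<in> carrier G" and x: "x \<in> carrier G" and xq: "x [^] (q :: int) = \<one>"
    and qw: "q dvd 8 * w\<^sup>2" and gx: "g \<otimes> x = x [^] (1 - 4 * w) \<otimes> g"
  shows "(x \<otimes> g) [^] i = x [^] (i - 2 * w * i * (i - 1)) \<otimes> g [^] (i :: int)"
proof (rule int_pow_unique[symmetric])
  fix n :: int
  have "(-4 * w)\<^sup>2 = 8 * w\<^sup>2 * 2" by (simp add: power2_eq_square)
  then have qe: "q dvd (-4 * w)\<^sup>2" using qw by (metis dvd_mult2)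
  have "x [^] (n - 2 * w * n * (n - 1)) \<otimes> g [^] n \<otimes> (x \<otimes> g) =
      x [^] (n - 2 * w * n * (n - 1)) \<otimes> (g [^] n \<otimes> x [^] (1::int)) \<otimes> g"
    using g x by (simp add: m_assoc)
  also have "\<dots> = x [^] (n - 2 * w * n * (n - 1)) \<otimes> x [^] (1 - 4 * n * w) \<otimes> g [^] (n + 1)"
    unfolding power_conjugation[OF g x xq qe, simplified, OF gx] using g x
    by (simp add: m_assoc int_pow_mult mult.commute mult.left_commute)
  also have "\<dots> = x [^] (n + 1 - 2 * w * (n + 1) * (n + 1 - 1)) \<otimes> g [^] (n + 1)"
    using g x by (simp add: algebra_simps flip: int_pow_mult)
  finally show "x [^] (n + 1 - 2 * w * (n + 1) * (n + 1 - 1)) \<otimes> g [^] (n + 1) =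
     x [^] (n - 2 * w * n * (n - 1)) \<otimes> g [^] n \<otimes> (x \<otimes> g)" by simp
qed (use g x in auto)

text \<open>The usual formula \<open>(g x)\<^sup>n = g\<^sup>n x\<^sup>n [x, g]\<^bsup>n choose 2\<^esup>\<close>, for a commutator that is a
  square \<open>z\<^sup>2\<close>.\<close>

lemma int_pow_mult_class_2:
  assumes carr: "g \<in> carrier G" "x \<in> carrier G" "z \<in> carrier G"
    and xg: "x \<otimes> g = g \<otimes> x \<otimes> z \<otimes> z" and zg: "g \<otimes> z = z \<otimes> g" and zx: "x \<otimes> z = z \<otimes> x"
  shows "(g \<otimes> x) [^] n = g [^] n \<otimes> x [^] n \<otimes> z [^] (n * (n - 1) :: int)"
proof (rule int_pow_unique[symmetric])
  fix n :: int
  have zg': "z [^] k \<otimes> g = g \<otimes> z [^] k" and zx': "z [^] k \<otimes> x = x \<otimes> z [^] k" for k :: int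
    using int_pow_intertwine[OF carr(1,3,3) zg] int_pow_intertwine[OF carr(2,3,3) zx] by simp_all
  have "x [^] n \<otimes> g = g \<otimes> (x \<otimes> (z \<otimes> z)) [^] n"
    using carr xg by (intro int_pow_intertwine[symmetric]) (simp_all add: m_assoc)
  also have "(x \<otimes> (z \<otimes> z)) [^] n = x [^] n \<otimes> (z \<otimes> z) [^] n"
    using carr zx by (intro int_pow_mult_distrib) (simp_all add: m_assoc[symmetric], simp add: m_assoc)
  also have "(z \<otimes> z) [^] n = z [^] (2 * n)"
    using carr int_pow_mult[of z n n] by (simp add: int_pow_mult_distrib)
  finally have xng: "x [^] n \<otimes> g = g \<otimes> (x [^] n \<otimes> z [^] (2 * n))" .
  have e: "(n + 1) * (n + 1 - 1) = 2 * n + n * (n - 1)" by (simp add: algebra_simps)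
  have "g [^] n \<otimes> x [^] n \<otimes> z [^] (n * (n - 1)) \<otimes> (g \<otimes> x) =
      g [^] n \<otimes> x [^] n \<otimes> (z [^] (n * (n - 1)) \<otimes> g) \<otimes> x"
    using carr by (simp add: m_assoc)
  also have "\<dots> = g [^] n \<otimes> (x [^] n \<otimes> g) \<otimes> (z [^] (n * (n - 1)) \<otimes> x)"
    unfolding zg' using carr by (simp add: m_assoc)
  also have "\<dots> = (g [^] n \<otimes> g) \<otimes> x [^] n \<otimes> (z [^] (2 * n) \<otimes> z [^] (n * (n - 1)) \<otimes> x)"
    unfolding xng using carr by (simp add: m_assoc)
  also have "\<dots> = (g [^] n \<otimes> g) \<otimes> x [^] n \<otimes> (z [^] (2 * n + n * (n - 1)) \<otimes> x)"
    using carr by (simp only: int_pow_mult)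
  also have "\<dots> = (g [^] n \<otimes> g) \<otimes> (x [^] n \<otimes> x) \<otimes> z [^] (2 * n + n * (n - 1))"
    unfolding zx' using carr by (simp add: m_assoc)
  also have "\<dots> = g [^] (n + 1) \<otimes> x [^] (n + 1) \<otimes> z [^] ((n + 1) * (n + 1 - 1))"
    using carr by (simp only: int_pow_mult int_pow_1 e)
  finally show "g [^] (n + 1) \<otimes> x [^] (n + 1) \<otimes> z [^] ((n + 1) * (n + 1 - 1)) =
      g [^] n \<otimes> x [^] n \<otimes> z [^] (n * (n - 1)) \<otimes> (g \<otimes> x)" by simp
qed (use carr in simp_all)

text \<open>When \<open>u = [x, b]\<close> and \<open>v = [y, a]\<close> are central and \<open>x\<close>, \<open>y\<close> commute with \<open>c = [a, b]\<close> and with each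
  other, \<open>[a x, b y]\<close> differs from \<open>c\<close> only by the central factor \<open>u v\<^sup>-\<^sup>1\<close>.\<close>

lemma mult_swap_perturbed:
  assumes carr: "a \<in> carrier G" "b \<in> carrier G" "c \<in> carrier G" "x \<in> carrier G" "y \<in> carrier G"
    and ab: "a \<otimes> b = b \<otimes> a \<otimes> c" and xb: "x \<otimes> b = b \<otimes> x \<otimes> u" and ya: "y \<otimes> a = a \<otimes> y \<otimes> v"
    and xy: "x \<otimes> y = y \<otimes> x" and xc: "x \<otimes> c = c \<otimes> x" and yc: "y \<otimes> c = c \<otimes> y"
    and u: "u \<in> center G" and v: "v \<in> center G"
  shows "(a \<otimes> x) \<otimes> (b \<otimes> y) = (b \<otimes> y) \<otimes> (a \<otimes> x) \<otimes> (c \<otimes> (u \<otimes> inv v))"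
proof -
  have uc: "u \<in> carrier G" and vc: "v \<in> carrier G" using u v by (auto simp: center_def)
  have uy: "u \<otimes> y = y \<otimes> u" and vx: "v \<otimes> x = x \<otimes> v" and vcu: "v \<otimes> (c \<otimes> u) = c \<otimes> u \<otimes> v"
    using u v carr uc by (simp_all only: center_def mem_Collect_eq m_closed)
  have "(a \<otimes> x) \<otimes> (b \<otimes> y) = a \<otimes> (x \<otimes> b) \<otimes> y" using carr by (simp add: m_assoc)
  also have "\<dots> = (a \<otimes> b) \<otimes> x \<otimes> (u \<otimes> y)" unfolding xb using carr uc by (simp add: m_assoc)
  also have "\<dots> = b \<otimes> a \<otimes> c \<otimes> (x \<otimes> y) \<otimes> u" unfolding uy ab using carr uc by (simp add: m_assoc)
  finally have lhs: "(a \<otimes> x) \<otimes> (b \<otimes> y) = b \<otimes> a \<otimes> c \<otimes> (x \<otimes> y) \<otimes> u" .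
  have "(b \<otimes> y) \<otimes> (a \<otimes> x) \<otimes> (c \<otimes> (u \<otimes> inv v)) = b \<otimes> (y \<otimes> a) \<otimes> x \<otimes> (c \<otimes> u) \<otimes> inv v"
    using carr uc vc by (simp add: m_assoc)
  also have "\<dots> = b \<otimes> a \<otimes> y \<otimes> (v \<otimes> x) \<otimes> (c \<otimes> u) \<otimes> inv v"
    unfolding ya using carr uc vc by (simp add: m_assoc)
  also have "\<dots> = b \<otimes> a \<otimes> y \<otimes> x \<otimes> (v \<otimes> (c \<otimes> u)) \<otimes> inv v"
    unfolding vx using carr uc vc by (simp add: m_assoc)
  also have "\<dots> = b \<otimes> a \<otimes> y \<otimes> (x \<otimes> c) \<otimes> u"
    unfolding vcu using carr uc vc by (simp add: m_assoc)
  also have "\<dots> = b \<otimes> a \<otimes> (y \<otimes> c) \<otimes> x \<otimes> u"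
    unfolding xc using carr uc vc by (simp add: m_assoc)
  also have "\<dots> = b \<otimes> a \<otimes> c \<otimes> (x \<otimes> y) \<otimes> u"
    unfolding yc xy using carr uc vc by (simp add: m_assoc)
  finally show ?thesis using lhs by simp
qed

end

section \<open>Normal forms\<close>

locale H_presentation =
  fixes H :: "('a, 'b) monoid_scheme" (structure) and A B :: 'a and m :: nat and l :: int
  assumes m: "m > 1" and l: "odd l" and pres: "has_presentation H (case_gen A B) (H_relators m l)"
begin

text \<open>With \<open>d = 2\<^sup>m\<^sup>-\<^sup>2\<close> all moduli that occur are small multiples of powers of \<open>d\<close>: \<open>2\<^sup>m = 4 d\<close>,
  \<open>2\<^sup>m\<^sup>-\<^sup>1 = 2 d\<close> and \<open>2\<^sup>2\<^sup>m\<^sup>-\<^sup>1 = 8 d\<^sup>2\<close>.\<close>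

definition d :: int where "d = 2 ^ (m - 2)"
definition q :: int where "q = 8 * d\<^sup>2"
definition w :: int where "w = d * l"

lemma four_d: "4 * d = 2 ^ m" and q_power: "q = 2 ^ (2 * m - 1)"
proof -
  obtain n where "m = n + 2" using m by (metis add.commute less_eqE Suc_1 Suc_leI)
  moreover from this have "2 * m - 1 = 3 + n * 2" by simp
  ultimately show "4 * d = 2 ^ m" "q = 2 ^ (2 * m - 1)"
    unfolding q_def d_def by (simp_all only: power_add power_mult) simp_all
qed

lemma four_w: "4 * w = 2 ^ m * l"
  unfolding w_def four_d[symmetric] by simp

lemma eight_w2: "8 * w\<^sup>2 = q * l\<^sup>2"
  by (simp add: q_def w_def power_mult_distrib)

lemma d_pos: "d > 0"
  by (simp add: d_def)

end

sublocale H_presentation \<subseteq> group H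
  using pres by (simp add: has_presentation_def)

sublocale H_presentation \<subseteq> modulus q w
  by unfold_locales (simp_all add: eight_w2, simp add: q_power)

context H_presentation
begin

definition C :: 'a where "C = commutator H A B"

lemma A: "A \<in> carrier H" and B: "B \<in> carrier H" and H_relations: "H_relations H m l A B"
proof -
  obtain \<phi> where \<phi>: "\<phi> \<in> hom free_group H" "\<And>g. \<phi> (free_gen g) = case_gen A B g"
      "kernel free_group H \<phi> = normal_closure free_group (H_relators m l)"
    using pres by (auto simp: has_presentation_def)
  interpret F: group "free_group :: gen fword set monoid" by (rule group_free_group)
  have "free_gen g \<in> carrier free_group" for g :: gen
    by (simp add: free_gen_def free_group_carrier)
  then have "case_gen A B g \<in> carrier H" for g using \<phi>(1,2) by (metis hom_in_carrier)
  from this[of GenA] this[of GenB] show "A \<in> carrier H" "B \<in> carrier H" by simp_all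
  have "\<phi> r = \<one>" if r: "r \<in> H_relators m l" for r
  proof -
    have "r = inv\<^bsub>free_group\<^esub> \<one>\<^bsub>free_group\<^esub> \<otimes>\<^bsub>free_group\<^esub> r \<otimes>\<^bsub>free_group\<^esub> \<one>\<^bsub>free_group\<^esub>"
      using r H_relators_closed[of m l] by auto
    then have "r \<in> normal_closure free_group (H_relators m l)"
      unfolding normal_closure_def by (intro generate.incl) (use r in blast)
    then show ?thesis unfolding \<phi>(3)[symmetric] by (simp add: kernel_def)
  qed
  then show "H_relations H m l A B"
    using H_relators_trivial_iff[OF group_axioms \<phi>(1), of m l] by (simp add: \<phi>(2))
qed

lemmas defining_relations = H_relationsD[OF A B H_relations, folded C_def four_w]

lemma C: "C \<in> carrier H" by (rule defining_relations)

lemma A_q: "A [^] q = \<one>" and B_q: "B [^] q = \<one>"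
  using defining_relations(5,6) int_pow_int[of H _ "2 ^ (2 * m - 1)"] by (simp_all add: q_power)

lemma int_pow_8w2:
  assumes "x \<in> carrier H" "x [^] q = \<one>" and i: "i = j + 8 * w\<^sup>2 * k"
  shows "x [^] i = x [^] j"
  by (rule int_pow_mod_eq[OF assms(1,2)]) (simp add: i mod_eq_dvd_iff q_dvd)

lemma q_dvd_square: "q dvd (4 * w)\<^sup>2" "q dvd (-4 * w)\<^sup>2"
proof -
  have "(4 * w)\<^sup>2 = q * (2 * l\<^sup>2)" using eight_w2 by (simp add: power2_eq_square)
  then show "q dvd (4 * w)\<^sup>2" by (metis dvd_triv_left)
  then show "q dvd (-4 * w)\<^sup>2" by simp
qed

lemma C_A: "C [^] k \<otimes> A [^] n = A [^] (n * (1 - 4 * k * w)) \<otimes> C [^] (k :: int)"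
proof -
  have "inv C \<otimes> A \<otimes> C = A [^] (1 + 4 * w)"
    using A C by (simp add: m_assoc defining_relations(3) inv_solve_left')
  then have "inv C \<otimes> A = A [^] (1 + 4 * w) \<otimes> inv C"
    using A C inv_solve_right[of "inv C \<otimes> A" "A [^] (1 + 4 * w)" C] by simp
  from power_conjugation[OF _ A A_q q_dvd_square(1) this, of "- k" n]
  show ?thesis using C by (simp add: int_pow_inv int_pow_neg mult.assoc mult.left_commute)
qed

lemma C_B: "C [^] k \<otimes> B [^] n = B [^] (n * (1 + 4 * k * w)) \<otimes> C [^] (k :: int)"
  using power_conjugation[OF C B B_q q_dvd_square(1) defining_relations(4), of k n] by (simp add: mult.assoc mult.left_commute)

text \<open>Because \<open>B\<^sup>-\<^sup>1 A B = A C\<close>, conjugating \<open>A\<^sup>i\<close> by \<open>B\<close> gives \<open>(A C)\<^sup>i\<close>.\<close>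

lemma A_B: "A [^] i \<otimes> B = B \<otimes> A [^] (i - 2 * w * i * (i - 1)) \<otimes> C [^] (i :: int)"
proof -
  have "B \<otimes> (A \<otimes> C) = A \<otimes> B" using A B C defining_relations(2) by (simp add: m_assoc)
  then have "B \<otimes> (A \<otimes> C) [^] i = A [^] i \<otimes> B" using A B C by (simp add: int_pow_intertwine)
  moreover have "C \<otimes> A = A [^] (1 - 4 * w) \<otimes> C" using C_A[of 1 1] A C by simp
  ultimately show ?thesis
    using int_pow_mult_twisted[OF C A A_q q_dvd] A B C by (simp add: m_assoc)
qed

text \<open>The order of \<open>C\<close> is bounded although no relator mentions it: take \<open>i = q\<close> in the formula for
  \<open>A\<^sup>i B\<close>.\<close>

lemma C_q: "C [^] q = \<one>"
proof -
  have "A [^] (q - 2 * w * q * (q - 1)) = \<one>"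
    using int_pow_mod_eq[OF A A_q, of "q - 2 * w * q * (q - 1)" 0] by (simp add: mod_eq_dvd_iff)
  then show ?thesis using A_B[of q] A_q B C by simp
qed

lemma B_A: "B [^] j \<otimes> A = A \<otimes> B [^] (j - 2 * w * j * (j - 1)) \<otimes> C [^] (- j :: int)"
proof -
  have "A \<otimes> (B \<otimes> inv C) = B \<otimes> A" using A B C defining_relations(2) by (simp add: m_assoc flip: m_assoc[of A B])
  then have "A \<otimes> (B \<otimes> inv C) [^] j = B [^] j \<otimes> A" using A B C by (simp add: int_pow_intertwine)
  moreover have "inv C \<otimes> B = B [^] (1 - 4 * w) \<otimes> inv C" using C_B[of "-1" 1] B C by (simp add: int_pow_neg)
  ultimately show ?thesis
    using int_pow_mult_twisted[OF _ B B_q q_dvd, of "inv C"] A B C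
    by (simp add: m_assoc int_pow_inv int_pow_neg)
qed

text \<open>Powers of \<open>B\<close> with exponent divisible by \<open>2\<^sup>m\<close> commute with \<open>A\<close> up to a central power of \<open>C\<close>. Such
  exponents arise when \<open>C\<^sup>k\<close> is moved past \<open>B\<close>.\<close>

lemma A_B_pow: "A [^] i \<otimes> B [^] (4 * k * w) = B [^] (4 * k * w) \<otimes> A [^] i \<otimes> C [^] (4 * i * k * w)"
proof -
  have CA: "C [^] (4 * k * w) \<otimes> A = A \<otimes> C [^] (4 * k * w)"
  proof -
    have "A [^] (1 - 4 * (4 * k * w) * w) = A [^] (1 :: int)"
      by (rule int_pow_8w2[OF A A_q, where k = "- 2 * k"]) (simp add: power2_eq_square)
    then show ?thesis using C_A[of "4 * k * w" 1] A by simp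
  qed
  have "B [^] (4 * k * w - 2 * w * (4 * k * w) * (4 * k * w - 1)) = B [^] (4 * k * w)"
    by (rule int_pow_8w2[OF B B_q, where k = "- k * (4 * k * w - 1)"])
      (simp add: power2_eq_square algebra_simps)
  then have "B [^] (4 * k * w) \<otimes> A = A \<otimes> B [^] (4 * k * w) \<otimes> inv (C [^] (4 * k * w))"
    using B_A[of "4 * k * w"] C by (simp add: int_pow_neg)
  then have "B [^] (4 * k * w) \<otimes> A \<otimes> C [^] (4 * k * w) = A \<otimes> B [^] (4 * k * w)"
    using A B C by (simp add: inv_solve_right)
  then have "B [^] (4 * k * w) \<otimes> (A \<otimes> C [^] (4 * k * w)) [^] i = A [^] i \<otimes> B [^] (4 * k * w)"
    using A B C by (simp add: int_pow_intertwine m_assoc)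
  moreover have "(A \<otimes> C [^] (4 * k * w)) [^] i = A [^] i \<otimes> C [^] (4 * i * k * w)"
    using A C CA by (simp add: int_pow_mult_distrib int_pow_pow ac_simps)
  ultimately show ?thesis using A B C by (simp add: m_assoc)
qed

fun nf :: "coords \<Rightarrow> 'a" where
  "nf (j, i, k) = B [^] j \<otimes> A [^] i \<otimes> C [^] k"

lemma nf_closed: "nf t \<in> carrier H"
  by (cases t) (simp add: A B C)

lemma nf_cong:
  assumes "reduce q t = reduce q t'"
  shows "nf t = nf t'"
proof -
  obtain j i k j' i' k' where t: "t = (j, i, k)" "t' = (j', i', k')" by (cases t; cases t')
  with assms have jik: "j mod q = j' mod q" "i mod q = i' mod q" "k mod q = k' mod q" by simp_all
  show ?thesis
    by (simp add: t int_pow_mod_eq[OF B B_q jik(1)] int_pow_mod_eq[OF A A_q jik(2)]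
        int_pow_mod_eq[OF C C_q jik(3)])
qed

lemma nf_C: "nf t \<otimes> C [^] n = nf (shiftC n t)"
  by (cases t) (simp add: A B C int_pow_mult m_assoc)

lemma nf_A: "nf t \<otimes> A [^] n = nf (shiftA w n t)"
proof -
  obtain j i k where t: "t = (j, i, k)" by (cases t)
  have "nf t \<otimes> A [^] n = B [^] j \<otimes> A [^] i \<otimes> (C [^] k \<otimes> A [^] n)"
    using A B C by (simp add: t m_assoc)
  also have "\<dots> = nf (shiftA w n t)"
    unfolding C_A using A B C by (simp add: t m_assoc int_pow_mult)
  finally show ?thesis .
qed

lemma nf_B1: "nf t \<otimes> B = nf (shiftB w 1 t)"
proof -
  obtain j i k where t: "t = (j, i, k)" by (cases t)
  have comm: "C [^] (4 * i * k * w) \<otimes> B = B \<otimes> C [^] (4 * i * k * w)"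
  proof -
    have "B [^] (1 + 4 * (4 * i * k * w) * w) = B [^] (1 :: int)"
      by (rule int_pow_8w2[OF B B_q, where k = "2 * i * k"]) (simp add: power2_eq_square)
    then show ?thesis using C_B[of "4 * i * k * w" 1] B by simp
  qed
  have "nf t \<otimes> B = B [^] j \<otimes> A [^] i \<otimes> (C [^] k \<otimes> B [^] (1 :: int))"
    using A B C by (simp add: t m_assoc)
  also have "\<dots> = B [^] j \<otimes> (A [^] i \<otimes> B [^] (4 * k * w)) \<otimes> B \<otimes> C [^] k"
    unfolding C_B using A B C by (simp add: m_assoc int_pow_mult add.commute[of 1])
  also have "\<dots> = B [^] (j + 4 * k * w) \<otimes> A [^] i \<otimes> (C [^] (4 * i * k * w) \<otimes> B) \<otimes> C [^] k"
    unfolding A_B_pow using A B C by (simp add: m_assoc int_pow_mult)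
  also have "\<dots> = B [^] (j + 4 * k * w) \<otimes> (A [^] i \<otimes> B) \<otimes> C [^] (4 * i * k * w) \<otimes> C [^] k"
    unfolding comm using A B C by (simp add: m_assoc)
  also have "\<dots> = B [^] (j + 4 * k * w) \<otimes> B \<otimes> A [^] (i - 2 * w * i * (i - 1)) \<otimes>
      (C [^] i \<otimes> C [^] (4 * i * k * w) \<otimes> C [^] k)"
    unfolding A_B using A B C by (simp add: m_assoc)
  also have "\<dots> = B [^] (j + 4 * k * w + 1) \<otimes> A [^] (i - 2 * w * i * (i - 1)) \<otimes> C [^] (i + 4 * i * k * w + k)"
    using A B C by (simp add: m_assoc int_pow_mult)
  also have "\<dots> = nf (shiftB w 1 t)" by (simp add: t algebra_simps)
  finally show ?thesis .
qed

lemma nf_B: "nf t \<otimes> B [^] n = nf (shiftB w n t)"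
proof -
  have "inv (nf t) \<otimes> nf (shiftB w n t) = B [^] n"
  proof (rule int_pow_unique)
    fix n
    have "nf (shiftB w n t) \<otimes> B = nf (shiftB w (n + 1) t)"
      unfolding nf_B1 by (rule nf_cong) (simp only: shiftB_add add.commute)
    then show "inv (nf t) \<otimes> nf (shiftB w (n + 1) t) = inv (nf t) \<otimes> nf (shiftB w n t) \<otimes> B"
      using B by (simp add: nf_closed m_assoc)
  qed (use B in \<open>auto simp: nf_closed shift_0\<close>)
  then show ?thesis using B by (simp add: nf_closed inv_solve_left')
qed

lemma nf_mult: "nf t \<otimes> nf (j, i, k) = nf (shiftC k (shiftA w i (shiftB w j t)))"
  using A B C by (simp add: m_assoc nf_closed flip: nf_A nf_B nf_C)

text \<open>The upper bound for the order of \<open>H\<close>: normal forms are stable under right multiplication by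
  the generators and their inverses, so evaluating any word from left to right never leaves them.\<close>

lemma nf_surj: assumes "x \<in> carrier H" shows "\<exists>t. x = nf t"
proof -
  obtain u where u: "x = eval_word H (case_gen A B) u"
    using has_presentation_generated[OF pres assms] by blast
  have closed: "case_gen A B g \<in> carrier H" for g by (cases g) (simp_all add: A B)
  have "\<exists>t'. nf t \<otimes> eval_word H (case_gen A B) u = nf t'" for t
  proof (induction u arbitrary: t)
    case Nil
    have "nf t \<otimes> eval_word H (case_gen A B) [] = nf t" by (simp add: nf_closed del: nf.simps)
    then show ?case by blast
  next
    case (Cons a u)
    obtain g b where a: "a = (g, b)" by force
    define s where "s = (if b then case_gen A B g else inv case_gen A B g)"
    have s: "s \<in> carrier H" using closed[of g] by (simp add: s_def)
    have "\<exists>t'. nf t \<otimes> s = nf t'"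
      using nf_A[of t 1] nf_A[of t "-1"] nf_B[of t 1] nf_B[of t "-1"] A B
      by (cases g) (auto simp: s_def int_pow_neg simp del: nf.simps split_paired_Ex)
    then obtain t' where "nf t \<otimes> s = nf t'" ..
    moreover have "eval_word H (case_gen A B) (a # u) = s \<otimes> eval_word H (case_gen A B) u"
      by (simp add: a s_def)
    ultimately have "nf t \<otimes> eval_word H (case_gen A B) (a # u) = nf t' \<otimes> eval_word H (case_gen A B) u"
      using s by (simp add: nf_closed eval_word_closed[OF closed] m_assoc[symmetric] del: nf.simps eval_word.simps)
    then show ?case using Cons by simp
  qed
  from this[of "(0, 0, 0)"] show ?thesis using assms u by auto
qed

declare nf.simps [simp del]

lemma nf_cases:
  assumes "x \<in> carrier H"
  obtains j i k where "x = nf (j, i, k)"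
  using nf_surj[OF assms] that by auto

text \<open>The lower bound for the order of \<open>H\<close>. The shifts are permutations of the residue triples that
  satisfy the defining relations, so \<open>H\<close> acts on the triples, and \<open>B\<^sup>j A\<^sup>i C\<^sup>k\<close> takes the origin to
  \<open>(j, i, k)\<close> modulo \<open>q\<close>.\<close>

lemma nf_inj:
  assumes "nf t = nf t'"
  shows "reduce q t = reduce q t'"
proof -
  let ?S = "BijGroup residues"
  interpret S: group ?S by (rule group_BijGroup)
  define a b c where "a = residue_map (shiftA w 1)" and "b = residue_map (shiftB w 1)"
    and "c = residue_map (shiftC 1)"
  have carr: "a \<in> carrier ?S" "b \<in> carrier ?S" "c \<in> carrier ?S"
    by (simp_all add: a_def b_def c_def BijGroup_def shift_Bij)
  have pow: "a [^]\<^bsub>?S\<^esub> n = residue_map (shiftA w n)" "b [^]\<^bsub>?S\<^esub> n = residue_map (shiftB w n)"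
    "c [^]\<^bsub>?S\<^esub> n = residue_map (shiftC n)" for n :: int
    by (simp_all add: a_def b_def c_def shift_pow[symmetric])
  have one: "residue_map f = \<one>\<^bsub>?S\<^esub>" if "\<And>t. reduce q (f t) = reduce q t" for f
    using that by (auto simp: BijGroup_def residue_map_def residues_def)
  have pow_q: "g [^]\<^bsub>?S\<^esub> ((2::nat) ^ (2 * m - 1)) = g [^]\<^bsub>?S\<^esub> q" for g
    by (simp add: q_power flip: int_pow_int)
  have "b \<otimes>\<^bsub>?S\<^esub> a = c \<otimes>\<^bsub>?S\<^esub> a \<otimes>\<^bsub>?S\<^esub> b"
  proof -
    have ab: "a \<otimes>\<^bsub>?S\<^esub> b = residue_map (shiftA w 1 \<circ> shiftB w 1)"
      by (simp add: a_def b_def residue_map_mult shift_Bij shift_reduce)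
    then have "residue_map (shiftA w 1 \<circ> shiftB w 1) \<in> Bij residues"
      using S.m_closed[OF carr(1,2)] by (simp add: BijGroup_def)
    then have "c \<otimes>\<^bsub>?S\<^esub> (a \<otimes>\<^bsub>?S\<^esub> b) = residue_map (shiftC 1 \<circ> (shiftA w 1 \<circ> shiftB w 1))"
      unfolding ab by (simp add: c_def residue_map_mult shift_Bij shift_reduce)
    moreover have "b \<otimes>\<^bsub>?S\<^esub> a = residue_map (shiftB w 1 \<circ> shiftA w 1)"
      by (simp add: a_def b_def residue_map_mult shift_Bij shift_reduce)
    moreover have "residue_map (shiftB w 1 \<circ> shiftA w 1) = residue_map (shiftC 1 \<circ> (shiftA w 1 \<circ> shiftB w 1))"
      by (rule residue_map_cong) (simp add: shiftA_shiftB)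
    ultimately show ?thesis using carr by (simp add: S.m_assoc)
  qed
  moreover have "c \<otimes>\<^bsub>?S\<^esub> a = a [^]\<^bsub>?S\<^esub> (1 + 2 ^ m * l) \<otimes>\<^bsub>?S\<^esub> c"
    unfolding pow unfolding a_def c_def
    by (simp add: residue_map_mult shift_Bij shift_reduce)
      (rule residue_map_cong, simp add: shiftA_shiftC flip: four_w)
  moreover have "b \<otimes>\<^bsub>?S\<^esub> c = c \<otimes>\<^bsub>?S\<^esub> b [^]\<^bsub>?S\<^esub> (1 + 2 ^ m * l)"
    unfolding pow unfolding b_def c_def
    by (simp add: residue_map_mult shift_Bij shift_reduce)
      (rule residue_map_cong, simp add: shiftC_shiftB flip: four_w)
  moreover have "a [^]\<^bsub>?S\<^esub> ((2::nat) ^ (2 * m - 1)) = \<one>\<^bsub>?S\<^esub>"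
    "b [^]\<^bsub>?S\<^esub> ((2::nat) ^ (2 * m - 1)) = \<one>\<^bsub>?S\<^esub>"
    unfolding pow_q pow by (rule one, simp add: shift_period)+
  ultimately have pair: "H_relations ?S m l (inv\<^bsub>?S\<^esub> a) (inv\<^bsub>?S\<^esub> b)"
    and comm: "commutator ?S (inv\<^bsub>?S\<^esub> a) (inv\<^bsub>?S\<^esub> b) = inv\<^bsub>?S\<^esub> c"
    using S.H_relations_inv[OF carr, of m l] by blast+
  have closed: "case_gen (inv\<^bsub>?S\<^esub> a) (inv\<^bsub>?S\<^esub> b) g \<in> carrier ?S" for g
    using carr by (cases g) simp_all
  obtain \<phi> where \<phi>: "\<phi> \<in> hom free_group ?S"
      "\<And>g. \<phi> (free_gen g) = case_gen (inv\<^bsub>?S\<^esub> a) (inv\<^bsub>?S\<^esub> b) g"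
  proof (rule S.free_group_extend[of "case_gen (inv\<^bsub>?S\<^esub> a) (inv\<^bsub>?S\<^esub> b)", OF closed])
    fix \<phi> assume "\<phi> \<in> hom free_group ?S"
      "\<And>g. \<phi> (free_gen g) = case_gen (inv\<^bsub>?S\<^esub> a) (inv\<^bsub>?S\<^esub> b) g"
    then show thesis by (rule that)
  qed
  have "\<phi> r = \<one>\<^bsub>?S\<^esub>" if "r \<in> H_relators m l" for r
    using H_relators_trivial_iff[OF S.group_axioms \<phi>(1), of m l] pair that by (simp add: \<phi>(2))
  then obtain \<psi> where \<psi>: "\<psi> \<in> hom H ?S" "\<And>g. \<psi> (case_gen A B g) = \<phi> (free_gen g)"
    using has_presentation_extend[OF pres H_relators_closed S.group_axioms \<phi>(1)] by blast
  interpret \<psi>: group_hom H ?S \<psi> by unfold_locales (rule \<psi>)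
  have AB: "\<psi> A = inv\<^bsub>?S\<^esub> a" "\<psi> B = inv\<^bsub>?S\<^esub> b"
    using \<psi>(2)[of GenA] \<psi>(2)[of GenB] \<phi>(2) by simp_all
  then have C': "\<psi> C = inv\<^bsub>?S\<^esub> c"
    using A B comm by (simp add: C_def commutator_def)
  \<comment> \<open>The right action of \<open>g\<close> is the permutation inverse to \<open>\<psi> g\<close>.\<close>
  have "(inv\<^bsub>?S\<^esub> (\<psi> (nf t))) (0, 0, 0) = reduce q t" for t
  proof -
    obtain j i k where t: "t = (j, i, k)" by (cases t)
    have "inv\<^bsub>?S\<^esub> (\<psi> (nf t)) = c [^]\<^bsub>?S\<^esub> k \<otimes>\<^bsub>?S\<^esub> (a [^]\<^bsub>?S\<^esub> i \<otimes>\<^bsub>?S\<^esub> b [^]\<^bsub>?S\<^esub> j)"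
      using A B C carr
      by (simp add: t nf.simps \<psi>.hom_int_pow AB C' S.int_pow_inv S.inv_mult_group)
    also have "\<dots> = compose residues (residue_map (shiftC k))
        (compose residues (residue_map (shiftA w i)) (residue_map (shiftB w j)))"
      unfolding pow by (simp add: BijGroup_def shift_Bij compose_Bij)
    finally have "(inv\<^bsub>?S\<^esub> (\<psi> (nf t))) (0, 0, 0) = reduce q (shiftC k (reduce q (shiftA w i (reduce q (j, 0, 0)))))"
      by (simp add: compose_def residue_map_def residues_def reduce_reduce del: reduce.simps)
        (simp add: reduce_reduce)
    also have "\<dots> = reduce q t"
      by (simp only: shift_reduce) (simp add: t)
    finally show ?thesis .
  qed
  from this[of t] this[of t'] show ?thesis by (simp add: assms)
qed

lemma nf_eq_iff: "nf t = nf t' \<longleftrightarrow> reduce q t = reduce q t'"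
  using nf_inj nf_cong by blast

end

section \<open>The centre and the second centre\<close>

context H_presentation
begin

lemma dvd_l_cancel: "2 ^ n dvd l * x \<longleftrightarrow> 2 ^ n dvd (x :: int)"
  using l by (simp add: coprime_dvd_mult_right_iff)

text \<open>These triples turn out to be the second centre. For them both products with an arbitrary normal
  form have coordinates that add up, except for one bilinear term in the exponent of \<open>C\<close>; hence the
  commutator of \<open>B\<^sup>j A\<^sup>i C\<^sup>k\<close> and \<open>B\<^sup>a A\<^sup>b C\<^sup>c\<close> is \<open>C\<^sup>a\<^sup>i\<^sup>-\<^sup>j\<^sup>b\<close>.\<close>

lemma nf_mult_near_central:
  assumes "4 * d dvd j" "4 * d dvd i" "2 * d dvd k"
  shows "nf (j, i, k) \<otimes> nf (a, b, c) = nf (j + a, i + b, k + c + a * i)"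
    and "nf (a, b, c) \<otimes> nf (j, i, k) = nf (a + j, b + i, c + k + j * b)"
proof -
  obtain j' i' k' where jik: "j = 4 * d * j'" "i = 4 * d * i'" "k = 2 * d * k'"
    using assms by (auto elim!: dvdE)
  have dvd: "q dvd x" if "x = 8 * d\<^sup>2 * y" for x y
    using that by (simp add: q_def)
  have "even (a * (a - 1))" "even (b * (b + 1))" by auto
  then obtain r s where r: "a * (a - 1) = 2 * r" and s: "b * (b + 1) = 2 * s" by (meson evenE)
  show "nf (j, i, k) \<otimes> nf (a, b, c) = nf (j + a, i + b, k + c + a * i)"
    unfolding nf_mult
  proof (rule nf_cong, unfold shiftB.simps shiftA.simps shiftC.simps reduce.simps prod.inject
      mod_eq_dvd_iff, intro conjI, goal_cases)
    case 1
    show ?case unfolding jik w_def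
      by (rule dvd[where y = "a * k' * l + a * (a - 1) * i' * l"])
        (use d_pos in \<open>simp add: algebra_simps power2_eq_square\<close>)
  next
    case 2
    show ?case unfolding jik w_def
      by (rule dvd[where y = "- (a * l * i' * (4 * d * i' - 1) + l * b *
            (k' + 16 * a * d\<^sup>2 * i' * k' * l + 2 * a * i' + 4 * r * d * l * i' * (4 * d * i' + 1)))"])
        (use arg_cong[OF r, of "\<lambda>z. 16 * d ^ 3 * l\<^sup>2 * b * i' * (4 * d * i' + 1) * z"]
          in \<open>simp add: algebra_simps power2_eq_square power3_eq_cube\<close>)
  next
    case 3
    show ?case unfolding jik w_def
      by (rule dvd[where y = "4 * a * d * i' * k' * l + r * l * i' * (4 * d * i' + 1)"])
        (use arg_cong[OF r, of "\<lambda>z. 4 * d\<^sup>2 * l * i' * (4 * d * i' + 1) * z"]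
          in \<open>simp add: algebra_simps power2_eq_square\<close>)
  qed
  define c' where "c' = c + 4 * j * b * c * w + j * b + j * (j - 1) * w * b * (b + 1)"
  show "nf (a, b, c) \<otimes> nf (j, i, k) = nf (a + j, b + i, c + k + j * b)"
    unfolding nf_mult
  proof (rule nf_cong, unfold shiftB.simps shiftA.simps shiftC.simps reduce.simps prod.inject
      mod_eq_dvd_iff c'_def[symmetric], intro conjI, goal_cases)
    case 1
    show ?case unfolding jik w_def
      by (rule dvd[where y = "2 * j' * c * l + j' * (4 * d * j' - 1) * b * l"])
        (simp add: algebra_simps power2_eq_square)
  next
    case 2
    show ?case unfolding jik w_def
      by (rule dvd[where y = "- (j' * l * b * (b - 1) + 2 * i' * l * c')"])
        (simp add: algebra_simps power2_eq_square)
  next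
    case 3
    show ?case unfolding c'_def jik w_def
      by (rule dvd[where y = "2 * j' * b * c * l + j' * (4 * d * j' - 1) * l * s"])
        (use arg_cong[OF s, of "\<lambda>z. 4 * d\<^sup>2 * j' * (4 * d * j' - 1) * l * z"]
          in \<open>simp add: algebra_simps power2_eq_square\<close>)
  qed
qed

text \<open>A converse. An element that commutes with both generators up to powers \<open>C\<^sup>e\<close> with
  \<open>2\<^sup>m\<^sup>-\<^sup>1\<close> dividing \<open>e\<close> has coordinates of the shape just considered. Comparing coordinates
  first gives divisibility of \<open>j\<close> and \<open>i\<close> by \<open>2\<^sup>m\<^sup>-\<^sup>1\<close>. The missing factor 2 comes from the terms
  \<open>2 j (j - 1) w\<close> and \<open>2 i (i - 1) w\<close>, whose cofactors \<open>j - 1\<close>, \<open>i - 1\<close> and \<open>\<ell>\<close> are odd. The case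
  \<open>e = e' = 0\<close> yields the centre, the general case the second centre.\<close>

lemma near_central_coords:
  assumes e: "2 * d dvd e" "2 * d dvd e'"
    and cA: "nf (j, i, k) \<otimes> A = nf (0, 0, e) \<otimes> (A \<otimes> nf (j, i, k))"
    and cB: "nf (j, i, k) \<otimes> B = nf (0, 0, e') \<otimes> (B \<otimes> nf (j, i, k))"
  shows "4 * d dvd j" and "4 * d dvd i" and "2 * d dvd k" and "q dvd j + e" and "q dvd i - e'"
proof -
  have AA: "nf (0, 1, 0) = A" and BB: "nf (1, 0, 0) = B" using A B by (simp_all add: nf.simps)
  have "nf (shiftA w 1 (j, i, k)) = nf (0, 0, e) \<otimes> nf (0, 1, 0) \<otimes> nf (j, i, k)"
    using cA nf_A[of "(j, i, k)" 1] A by (simp add: m_assoc nf_closed AA del: shiftA.simps)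
  also have "nf (0, 0, e) \<otimes> nf (0, 1, 0) = nf (0, 1, e)"
    using e by (subst nf_mult_near_central) simp_all
  finally have EA: "q dvd j - (j + 4 * j * e * w + 2 * j * (j - 1) * w)"
    "q dvd k - (e + 4 * j * e * w + j + 2 * j * (j - 1) * w + k)"
    unfolding nf_mult nf_eq_iff by (simp_all add: mod_eq_dvd_iff algebra_simps)
  have "nf (shiftB w 1 (j, i, k)) = nf (0, 0, e') \<otimes> nf (1, 0, 0) \<otimes> nf (j, i, k)"
    using cB nf_B[of "(j, i, k)" 1] B by (simp add: m_assoc nf_closed BB del: shiftB.simps)
  also have "nf (0, 0, e') \<otimes> nf (1, 0, 0) = nf (1, 0, e')"
    using e by (subst nf_mult_near_central) simp_all
  finally have EB: "q dvd j + 1 + 4 * k * w - (1 + j + 4 * j * e' * w)"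
    "q dvd i - 2 * w * i * (i - 1) - i * (1 - 4 * e' * w)"
    "q dvd k + 4 * i * k * w + i - (e' + k)"
    unfolding nf_mult nf_eq_iff by (simp_all add: mod_eq_dvd_iff algebra_simps)
  have ew: "q dvd 4 * x * w" if "2 * d dvd x" for x
    using that by (auto simp: q_def w_def power2_eq_square elim!: dvdE)
  have eje: "q dvd 4 * j * e * w" "q dvd 4 * j * e' * w" "q dvd 4 * i * e' * w"
    using ew[of "j * e"] ew[of "j * e'"] ew[of "i * e'"] e by (simp_all add: mult.assoc)
  have two_d_q: "2 * d dvd q" by (simp add: q_def power2_eq_square)
  have kw: "q dvd 4 * k * w"
  proof -
    have "4 * k * w = (j + 1 + 4 * k * w - (1 + j + 4 * j * e' * w)) + 4 * j * e' * w" by simp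
    then show ?thesis using EB(1) eje(2) by (metis dvd_add)
  qed
  have "2 * d * 2 = 2 ^ (m - 1) * 2" using four_d m by (simp flip: power_Suc2)
  then have two_d: "2 * d = 2 ^ (m - 1)" by simp
  have "4 * d * (2 * d) dvd 4 * d * (l * k)"
    using kw by (simp add: q_def w_def power2_eq_square ac_simps)
  then show k: "2 * d dvd k"
    using d_pos dvd_l_cancel unfolding two_d by simp
  have "j + e = - (k - (e + 4 * j * e * w + j + 2 * j * (j - 1) * w + k)) + (j - (j + 4 * j * e * w + 2 * j * (j - 1) * w))"
    by simp
  then show je: "q dvd j + e" using EA by (metis dvd_add dvd_minus_iff)
  have "i - e' = (k + 4 * i * k * w + i - (e' + k)) - i * (4 * k * w)" by simp
  then show ie: "q dvd i - e'" using EB(3) kw by (metis dvd_diff dvd_mult)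
  have odd_part: "4 * d dvd x" if x: "2 * d dvd x" and xw: "q dvd 2 * x * (x - 1) * w" for x
  proof -
    have "2 * d * (4 * d) dvd 2 * d * (l * (x * (x - 1)))"
      using xw by (simp add: q_def w_def power2_eq_square ac_simps)
    then have "2 ^ m dvd x * (x - 1)"
      using d_pos dvd_l_cancel unfolding four_d by simp
    moreover have "even x" using x by (metis dvd_mult_left)
    ultimately show ?thesis unfolding four_d by (simp add: coprime_dvd_mult_left_iff)
  qed
  have j: "2 * d dvd j" using je e(1) two_d_q by (metis dvd_trans dvd_add_left_iff)
  have i: "2 * d dvd i" using ie e(2) two_d_q by (metis dvd_trans dvd_diff_commute dvd_diff_right_iff)
  show "4 * d dvd j"
  proof (rule odd_part[OF j])
    have "2 * j * (j - 1) * w = - (j - (j + 4 * j * e * w + 2 * j * (j - 1) * w)) - 4 * j * e * w" by simp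
    then show "q dvd 2 * j * (j - 1) * w" using EA(1) eje(1) by (metis dvd_diff dvd_minus_iff)
  qed
  show "4 * d dvd i"
  proof (rule odd_part[OF i])
    have "2 * i * (i - 1) * w = - (i - 2 * w * i * (i - 1) - i * (1 - 4 * e' * w)) + 4 * i * e' * w"
      by (simp add: algebra_simps)
    then show "q dvd 2 * i * (i - 1) * w" using EB(2) eje(3) by (metis dvd_add dvd_minus_iff)
  qed
qed

lemma mem_center_iff: "x \<in> center H \<longleftrightarrow> (\<exists>k. 2 * d dvd k \<and> x = nf (0, 0, k))"
proof
  assume x: "x \<in> center H"
  then have "x \<in> carrier H" by (simp add: center_def)
  then obtain j i k where jik: "x = nf (j, i, k)" by (rule nf_cases)
  have 1: "nf (0, 0, 0) = \<one>" by (simp add: nf.simps)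
  have "nf (j, i, k) \<otimes> A = nf (0, 0, 0) \<otimes> (A \<otimes> nf (j, i, k))" "nf (j, i, k) \<otimes> B = nf (0, 0, 0) \<otimes> (B \<otimes> nf (j, i, k))"
    using x A B unfolding 1 by (simp_all add: center_def nf_closed jik)
  from near_central_coords[OF _ _ this]
  have "2 * d dvd k" "q dvd j" "q dvd i" by simp_all
  moreover from this have "nf (j, i, k) = nf (0, 0, k)" by (intro nf_cong) (simp add: mod_eq_0_iff_dvd)
  ultimately show "\<exists>k. 2 * d dvd k \<and> x = nf (0, 0, k)" unfolding jik by blast
next
  assume "\<exists>k. 2 * d dvd k \<and> x = nf (0, 0, k)"
  then obtain k where k: "2 * d dvd k" "x = nf (0, 0, k)" by blast
  have "x \<otimes> g = g \<otimes> x" if g: "g \<in> carrier H" for g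
  proof -
    obtain a b c where "g = nf (a, b, c)" by (rule nf_cases[OF g])
    then show ?thesis
      using k nf_mult_near_central[of 0 0 k a b c] by (simp add: add.commute)
  qed
  then show "x \<in> center H" by (simp add: center_def k nf_closed)
qed

definition Z2 :: "'a set" where "Z2 = upper_central H 2"

lemma mem_Z2_iff:
  "x \<in> Z2 \<longleftrightarrow> (\<exists>j i k. 4 * d dvd j \<and> 4 * d dvd i \<and> 2 * d dvd k \<and> x = nf (j, i, k))"
proof
  assume x: "x \<in> Z2"
  then have "x \<in> carrier H" by (simp add: Z2_def upper_central_2)
  then obtain j i k where jik: "x = nf (j, i, k)" by (rule nf_cases)
  have comm: "\<exists>e. 2 * d dvd e \<and> nf (j, i, k) \<otimes> g = nf (0, 0, e) \<otimes> (g \<otimes> nf (j, i, k))" if g: "g \<in> carrier H" for g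
  proof -
    obtain z where "z \<in> center H" and z: "nf (j, i, k) \<otimes> g = z \<otimes> (g \<otimes> nf (j, i, k))"
      using x[unfolded Z2_def upper_central_2 mem_Collect_eq, THEN conjunct2, rule_format, OF g]
      unfolding jik by (elim bexE)
    then obtain e where "2 * d dvd e" "z = nf (0, 0, e)" unfolding mem_center_iff by (elim exE conjE)
    then show ?thesis using z by (intro exI[of _ e]) simp
  qed
  obtain e where e: "2 * d dvd e" "nf (j, i, k) \<otimes> A = nf (0, 0, e) \<otimes> (A \<otimes> nf (j, i, k))"
    using comm[OF A] by (elim exE conjE)
  obtain e' where e': "2 * d dvd e'" "nf (j, i, k) \<otimes> B = nf (0, 0, e') \<otimes> (B \<otimes> nf (j, i, k))"
    using comm[OF B] by (elim exE conjE)
  show "\<exists>j i k. 4 * d dvd j \<and> 4 * d dvd i \<and> 2 * d dvd k \<and> x = nf (j, i, k)"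
    using near_central_coords(1-3)[OF e(1) e'(1) e(2) e'(2)] jik by blast
next
  assume "\<exists>j i k. 4 * d dvd j \<and> 4 * d dvd i \<and> 2 * d dvd k \<and> x = nf (j, i, k)"
  then obtain j i k where jik: "4 * d dvd j" "4 * d dvd i" "2 * d dvd k" "x = nf (j, i, k)" by blast
  have "\<exists>z\<in>center H. x \<otimes> g = z \<otimes> (g \<otimes> x)" if g: "g \<in> carrier H" for g
  proof -
    obtain a b c where gabc: "g = nf (a, b, c)" by (rule nf_cases[OF g])
    define e where "e = a * i - j * b"
    have "2 * d dvd 4 * d" by simp
    then have e: "2 * d dvd e" unfolding e_def using jik by (meson dvd_diff dvd_mult dvd_mult2 dvd_trans)
    have "nf (0, 0, e) \<otimes> nf (a + j, b + i, c + k + j * b) = nf (a + j, b + i, e + (c + k + j * b))"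
      using nf_mult_near_central(1)[of 0 0 e] e by simp
    then have "x \<otimes> g = nf (0, 0, e) \<otimes> (g \<otimes> x)"
      unfolding jik(4) gabc nf_mult_near_central[OF jik(1-3)] by (simp add: e_def algebra_simps)
    then show ?thesis using e mem_center_iff by blast
  qed
  then show "x \<in> Z2" by (simp add: Z2_def upper_central_2 jik(4) nf_closed)
qed

lemma nf_in_Z2: "\<lbrakk>4 * d dvd j; 4 * d dvd i; 2 * d dvd k\<rbrakk> \<Longrightarrow> nf (j, i, k) \<in> Z2"
  unfolding mem_Z2_iff by blast

lemma Z2_closed: "x \<in> Z2 \<Longrightarrow> x \<in> carrier H"
  by (simp add: Z2_def upper_central_2)

lemma Z2_mult:
  assumes "4 * d dvd j" "4 * d dvd i" "2 * d dvd k" and "4 * d dvd j'"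
  shows "nf (j, i, k) \<otimes> nf (j', i', k') = nf (j + j', i + i', k + k')"
proof -
  have "4 * d * (4 * d) dvd j' * i" using assms by (intro mult_dvd_mono)
  moreover have "q dvd 4 * d * (4 * d)" by (simp add: q_def power2_eq_square)
  ultimately have "q dvd j' * i" by (rule dvd_trans[rotated])
  then have "nf (j + j', i + i', k + k' + j' * i) = nf (j + j', i + i', k + k')"
    by (intro nf_cong) (simp add: mod_eq_dvd_iff)
  then show ?thesis using nf_mult_near_central(1)[OF assms(1-3), of j' i' k'] by simp
qed

lemma Z2_comm: "x \<in> Z2 \<Longrightarrow> y \<in> Z2 \<Longrightarrow> x \<otimes> y = y \<otimes> x"
  unfolding mem_Z2_iff by (auto simp: Z2_mult add.commute)

lemma Z2_C: "x \<in> Z2 \<Longrightarrow> x \<otimes> C = C \<otimes> x"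
proof -
  assume "x \<in> Z2"
  then obtain j i k where jik: "4 * d dvd j" "4 * d dvd i" "2 * d dvd k" "x = nf (j, i, k)"
    unfolding mem_Z2_iff by blast
  have "nf (0, 0, 1) = C" using C by (simp add: nf.simps)
  then show ?thesis
    using nf_mult_near_central[OF jik(1-3), of 0 0 1] jik(4) by (simp add: add.commute)
qed

lemma Z2_exponent:
  assumes "x \<in> Z2"
  shows "x [^] (4 * d) = \<one>"
proof -
  obtain j i k where jik: "4 * d dvd j" "4 * d dvd i" "2 * d dvd k" "x = nf (j, i, k)"
    using assms unfolding mem_Z2_iff by blast
  have "nf (n * j, n * i, n * k) = x [^] n" for n
  proof (rule int_pow_unique)
    fix n
    show "nf ((n + 1) * j, (n + 1) * i, (n + 1) * k) = nf (n * j, n * i, n * k) \<otimes> x"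
      using jik by (simp add: Z2_mult algebra_simps)
  next
    show "nf (0 * j, 0 * i, 0 * k) = \<one>" by (simp add: nf.simps)
  qed (use assms Z2_closed nf_closed in simp_all)
  from this[of "4 * d", symmetric] have "x [^] (4 * d) = nf (4 * d * j, 4 * d * i, 4 * d * k)" .
  also have "\<dots> = nf (0, 0, 0)"
    using jik(1-3) by (intro nf_cong) (auto simp: q_def power2_eq_square elim!: dvdE)
  also have "\<dots> = \<one>" by (simp add: nf.simps)
  finally show ?thesis .
qed

text \<open>The commutator is a square of a central element, not just central: the coordinates \<open>j\<close>, \<open>i\<close> of
  \<open>x\<close> are divisible by \<open>2\<^sup>m\<close> while \<open>C\<^sup>e\<close> is central already when \<open>2\<^sup>m\<^sup>-\<^sup>1\<close> divides \<open>e\<close>. The square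
  root cancels the denominator of the binomial coefficient in the power formula for \<open>g x\<close>.\<close>

lemma Z2_commutator:
  assumes "x \<in> Z2" "g \<in> carrier H"
  obtains z where "z \<in> center H" "z [^] (4 * d) = \<one>" "x \<otimes> g = g \<otimes> x \<otimes> z \<otimes> z"
proof -
  obtain j i k where jik: "4 * d dvd j" "4 * d dvd i" "2 * d dvd k" "x = nf (j, i, k)"
    using assms unfolding mem_Z2_iff by blast
  then obtain j' i' where ji': "j = 4 * d * j'" "i = 4 * d * i'" by (auto elim!: dvdE)
  obtain a b c where g: "g = nf (a, b, c)" by (rule nf_cases[OF assms(2)])
  define e where "e = 2 * d * (a * i' - j' * b)"
  have e: "2 * d dvd e" by (simp add: e_def)
  define z where "z = nf (0, 0, e)"
  have z: "z \<in> center H" unfolding z_def mem_center_iff using e by blast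
  then have z2: "z \<in> Z2" unfolding mem_Z2_iff z_def using e
    by - (rule exI[of _ 0], rule exI[of _ 0], rule exI[of _ e], simp)
  have "x \<otimes> g = nf (a + j, b + i, c + k + j * b + e + e)"
    unfolding jik(4) g nf_mult_near_central[OF jik(1-3)]
    by (simp add: e_def ji' algebra_simps)
  also have "\<dots> = g \<otimes> x \<otimes> z \<otimes> z"
    unfolding jik(4) g z_def nf_mult_near_central[OF jik(1-3)]
    using e by (simp add: nf_mult_near_central(2))
  finally show thesis using that z z2 Z2_exponent by blast
qed

lemma card_Z2: "card Z2 = 2 ^ (3 * m - 2)"
proof -
  let ?f = "\<lambda>(a, b, c). nf (4 * d * a, 4 * d * b, 2 * d * c)"
  let ?I = "{0..<2 * d} \<times> {0..<2 * d} \<times> {0..<4 * d}"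
  have q1: "q = 4 * d * (2 * d)" and q2: "q = 2 * d * (4 * d)" by (simp_all add: q_def power2_eq_square)
  have mod4: "4 * d * (a mod (2 * d)) = 4 * d * a mod q"
    and mod2: "2 * d * (a mod (4 * d)) = 2 * d * a mod q" for a
    unfolding q1 by (rule mult_mod_right) (unfold q1[symmetric] q2, rule mult_mod_right)
  have inj: "inj_on ?f ?I"
  proof (rule inj_onI)
    fix p p' assume p: "p \<in> ?I" "p' \<in> ?I" and eq: "?f p = ?f p'"
    obtain a b c a' b' c' where pp: "p = (a, b, c)" "p' = (a', b', c')" by (cases p; cases p')
    have *: "nf (4 * d * a, 4 * d * b, 2 * d * c) = nf (4 * d * a', 4 * d * b', 2 * d * c')"
      using eq by (simp add: pp)
    have "(4 * d * a) mod q = (4 * d * a') mod q" "(4 * d * b) mod q = (4 * d * b') mod q"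
      "(2 * d * c) mod q = (2 * d * c') mod q"
      using * unfolding nf_eq_iff by simp_all
    then have "a mod (2 * d) = a' mod (2 * d)" "b mod (2 * d) = b' mod (2 * d)" "c mod (4 * d) = c' mod (4 * d)"
      using d_pos unfolding mod4[symmetric] mod2[symmetric] by simp_all
    then show "p = p'"
      using p by (simp add: pp)
  qed
  have img: "?f ` ?I = Z2"
  proof
    have "nf (4 * d * a, 4 * d * b, 2 * d * c) \<in> Z2" for a b c
      by (rule nf_in_Z2) simp_all
    then show "?f ` ?I \<subseteq> Z2" by auto
    show "Z2 \<subseteq> ?f ` ?I"
    proof
      fix x assume "x \<in> Z2"
      then obtain j i k where "4 * d dvd j" "4 * d dvd i" "2 * d dvd k" and x: "x = nf (j, i, k)"
        unfolding mem_Z2_iff by blast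
      then obtain a b c where abc: "j = 4 * d * a" "i = 4 * d * b" "k = 2 * d * c" by (auto elim!: dvdE)
      have "x = ?f (a mod (2 * d), b mod (2 * d), c mod (4 * d))"
        unfolding x abc prod.case mod4 mod2 by (rule nf_cong) simp
      moreover have "(a mod (2 * d), b mod (2 * d), c mod (4 * d)) \<in> ?I" using d_pos by simp
      ultimately show "x \<in> ?f ` ?I" by (rule image_eqI)
    qed
  qed
  have "card Z2 = card ?I" using card_image[OF inj] unfolding img .
  also have "\<dots> = nat (2 * d) * nat (2 * d) * nat (4 * d)" by (simp add: card_cartesian_product)
  also have "\<dots> = 2 ^ (3 * m - 2)"
  proof -
    obtain n where n: "m = n + 2" using m by (metis add.commute less_eqE Suc_1 Suc_leI)
    have "d = 2 ^ n" unfolding d_def using n by simp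
    then have "nat (2 * d) = 2 ^ (n + 1)" "nat (4 * d) = 2 ^ (n + 2)"
      by (simp_all add: nat_mult_distrib nat_power_eq)
    moreover have "3 * m - 2 = (n + 1) + (n + 1) + (n + 2)" using n by simp
    ultimately show ?thesis by (simp only: power_add)
  qed
  finally show ?thesis .
qed

end

section \<open>The 2-central automorphisms\<close>

context H_presentation
begin

lemma centerD: "z \<in> center H \<Longrightarrow> g \<in> carrier H \<Longrightarrow> z \<otimes> g = g \<otimes> z"
  and center_closed: "z \<in> center H \<Longrightarrow> z \<in> carrier H"
  by (simp_all only: center_def mem_Collect_eq)

text \<open>For the exponents that occur in the relators, a factor from the second centre behaves as if it
  commuted with \<open>g\<close>. Here \<open>x\<close> and the root \<open>z\<close> of the commutator have exponent dividing \<open>2\<^sup>m\<close>, and \<open>2\<^sup>m\<close>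
  divides both \<open>\<alpha> - 1\<close> and \<open>q\<close>.\<close>

lemma int_pow_mult_Z2:
  assumes x: "x \<in> Z2" and g: "g \<in> carrier H"
  shows "4 * d dvd n \<Longrightarrow> (g \<otimes> x) [^] n = g [^] n"
    and "4 * d dvd n - 1 \<Longrightarrow> (g \<otimes> x) [^] n = g [^] n \<otimes> x"
proof -
  obtain z where z: "z \<in> center H" "z [^] (4 * d) = \<one>" "x \<otimes> g = g \<otimes> x \<otimes> z \<otimes> z"
    using Z2_commutator[OF x g] .
  note xc = Z2_closed[OF x] and zc = center_closed[OF z(1)]
  have eq: "(g \<otimes> x) [^] n = g [^] n \<otimes> x [^] n \<otimes> z [^] (n * (n - 1))"
    using int_pow_mult_class_2[OF g xc zc z(3)] centerD[OF z(1) g] centerD[OF z(1) xc] by simp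
  have z1: "z [^] (n * (n - 1)) = \<one>" if "4 * d dvd n * (n - 1)"
    using int_pow_mod_eq[OF zc z(2), of "n * (n - 1)" 0] that by (simp add: mod_eq_dvd_iff)
  show "(g \<otimes> x) [^] n = g [^] n" if "4 * d dvd n"
    using int_pow_mod_eq[OF xc Z2_exponent[OF x], of n 0] that z1 eq g by (simp add: mod_eq_dvd_iff)
  show "(g \<otimes> x) [^] n = g [^] n \<otimes> x" if "4 * d dvd n - 1"
    using int_pow_mod_eq[OF xc Z2_exponent[OF x], of n 1] that z1 eq g xc by (simp add: mod_eq_dvd_iff)
qed

text \<open>The pair \<open>A x\<close>, \<open>B y\<close> has commutator \<open>C s\<close> with \<open>s\<close> central of exponent dividing \<open>2\<^sup>m\<^sup>-\<^sup>1\<close>, and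
  \<open>(A x)\<^sup>\<alpha> = A\<^sup>\<alpha> x\<close>. As \<open>x\<close> commutes with \<open>C\<close>, the relations for \<open>A\<close> and \<open>B\<close> carry over. The
  second centre is generated by \<open>A\<close> and \<open>B\<close> to the power \<open>2\<^sup>m\<close> and \<open>C\<close> to the power \<open>2\<^sup>m\<^sup>-\<^sup>1\<close>, and none of
  these powers changes when \<open>A x\<close>, \<open>B y\<close>, \<open>C s\<close> replace \<open>A\<close>, \<open>B\<close>, \<open>C\<close>.\<close>

lemma Z2_endomorphism:
  assumes x: "x \<in> Z2" and y: "y \<in> Z2"
  obtains \<psi> where "\<psi> \<in> hom H H" "\<psi> A = A \<otimes> x" "\<psi> B = B \<otimes> y" "\<And>z. z \<in> Z2 \<Longrightarrow> \<psi> z = z"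
proof -
  obtain z where z: "z \<in> center H" "z [^] (4 * d) = \<one>" "x \<otimes> B = B \<otimes> x \<otimes> z \<otimes> z"
    using Z2_commutator[OF x B] .
  obtain t where t: "t \<in> center H" "t [^] (4 * d) = \<one>" "y \<otimes> A = A \<otimes> y \<otimes> t \<otimes> t"
    using Z2_commutator[OF y A] .
  interpret Z: normal "center H" H by (rule center_normal)
  note xc = Z2_closed[OF x] and yc = Z2_closed[OF y] and zc = center_closed[OF z(1)] and tc = center_closed[OF t(1)]
  define s where "s = z \<otimes> z \<otimes> inv (t \<otimes> t)"
  have s: "s \<in> center H" using z(1) t(1) by (simp add: s_def)
  note sc = center_closed[OF s]
  have s_pow: "s [^] k = \<one>" if "2 * d dvd k" for k
  proof -
    from that obtain n where k: "k = 2 * d * n" by (rule dvdE)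
    have sq: "(g \<otimes> g) [^] (2 * d) = \<one>" if "g \<in> carrier H" "g [^] (4 * d) = \<one>" for g
    proof -
      have "(g \<otimes> g) [^] (2 * d) = g [^] (2 * d + 2 * d)"
        using that(1) by (simp only: int_pow_mult int_pow_mult_distrib)
      then show ?thesis using that(2) by simp
    qed
    have "(z \<otimes> z) \<otimes> inv (t \<otimes> t) = inv (t \<otimes> t) \<otimes> (z \<otimes> z)"
      using centerD[OF Z.m_closed[OF z(1) z(1)]] tc by simp
    then have "s [^] (2 * d) = (z \<otimes> z) [^] (2 * d) \<otimes> inv ((t \<otimes> t) [^] (2 * d))"
      unfolding s_def using zc tc by (subst int_pow_mult_distrib) (simp_all only: int_pow_inv m_closed inv_closed)
    then have "s [^] (2 * d) = \<one>" by (simp add: sq[OF zc z(2)] sq[OF tc t(2)])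
    then show ?thesis using sc by (simp add: k flip: int_pow_pow)
  qed
  have ab: "(A \<otimes> x) \<otimes> (B \<otimes> y) = (B \<otimes> y) \<otimes> (A \<otimes> x) \<otimes> (C \<otimes> s)"
    unfolding s_def
    by (rule mult_swap_perturbed)
      (use A B C xc yc zc tc z t defining_relations(2) Z2_comm[OF x y] Z2_C[OF x] Z2_C[OF y] in \<open>simp_all add: m_assoc\<close>)
  have dvd: "4 * d dvd 1 + 4 * w - 1" by (simp add: w_def)
  have ac: "(A \<otimes> x) \<otimes> (C \<otimes> s) = (C \<otimes> s) \<otimes> (A \<otimes> x) [^] (1 + 4 * w)"
  proof -
    have "(A \<otimes> x) \<otimes> (C \<otimes> s) = A \<otimes> (x \<otimes> C) \<otimes> s" using A xc C sc by (simp add: m_assoc)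
    also have "\<dots> = (A \<otimes> C) \<otimes> x \<otimes> s" unfolding Z2_C[OF x] using A xc C sc by (simp add: m_assoc)
    also have "\<dots> = C \<otimes> ((A [^] (1 + 4 * w) \<otimes> x) \<otimes> s)" unfolding defining_relations(3) using A xc C sc by (simp add: m_assoc)
    also have "\<dots> = C \<otimes> (s \<otimes> (A [^] (1 + 4 * w) \<otimes> x))"
      using A xc by (simp only: centerD[OF s] m_closed int_pow_closed)
    also have "\<dots> = (C \<otimes> s) \<otimes> (A [^] (1 + 4 * w) \<otimes> x)"
      using A xc C sc by (simp add: m_assoc)
    finally show ?thesis unfolding int_pow_mult_Z2(2)[OF x A dvd] .
  qed
  have cb: "(C \<otimes> s) \<otimes> (B \<otimes> y) = (B \<otimes> y) [^] (1 + 4 * w) \<otimes> (C \<otimes> s)"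
  proof -
    have "(C \<otimes> s) \<otimes> (B \<otimes> y) = C \<otimes> (s \<otimes> (B \<otimes> y))"
      using B yc C sc by (simp add: m_assoc)
    also have "\<dots> = C \<otimes> ((B \<otimes> y) \<otimes> s)"
      using B yc by (simp only: centerD[OF s] m_closed)
    also have "\<dots> = (C \<otimes> B) \<otimes> y \<otimes> s"
      using B yc C sc by (simp add: m_assoc)
    also have "\<dots> = B [^] (1 + 4 * w) \<otimes> (C \<otimes> y) \<otimes> s"
      unfolding defining_relations(4) using B yc C sc by (simp add: m_assoc)
    also have "\<dots> = (B [^] (1 + 4 * w) \<otimes> y) \<otimes> (C \<otimes> s)"
      unfolding Z2_C[OF y, symmetric] using B yc C sc by (simp add: m_assoc)
    finally show ?thesis unfolding int_pow_mult_Z2(2)[OF y B dvd] .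
  qed
  have "4 * d dvd q" by (simp add: q_def power2_eq_square)
  then have pow: "(A \<otimes> x) [^] ((2::nat) ^ (2 * m - 1)) = \<one>" "(B \<otimes> y) [^] ((2::nat) ^ (2 * m - 1)) = \<one>"
    using int_pow_mult_Z2(1)[OF x A, of q] int_pow_mult_Z2(1)[OF y B, of q] A_q B_q
    by (simp_all add: q_power flip: int_pow_int)
  have pair: "H_relations H m l (A \<otimes> x) (B \<otimes> y)" and comm: "commutator H (A \<otimes> x) (B \<otimes> y) = C \<otimes> s"
    using H_relationsI[of "A \<otimes> x" "B \<otimes> y" "C \<otimes> s" m l] ab ac cb pow A B C xc yc sc unfolding four_w by simp_all
  have closed: "case_gen (A \<otimes> x) (B \<otimes> y) g \<in> carrier H" for g
    using A B xc yc by (cases g) simp_all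
  obtain \<phi> where \<phi>: "\<phi> \<in> hom free_group H" "\<And>g. \<phi> (free_gen g) = case_gen (A \<otimes> x) (B \<otimes> y) g"
  proof (rule free_group_extend[of "case_gen (A \<otimes> x) (B \<otimes> y)", OF closed])
    fix \<phi> assume "\<phi> \<in> hom free_group H" "\<And>g. \<phi> (free_gen g) = case_gen (A \<otimes> x) (B \<otimes> y) g"
    then show thesis by (rule that)
  qed
  have "\<phi> r = \<one>" if "r \<in> H_relators m l" for r
    using H_relators_trivial_iff[OF group_axioms \<phi>(1), of m l] pair that by (simp add: \<phi>(2))
  then obtain \<psi> where \<psi>: "\<psi> \<in> hom H H" "\<And>g. \<psi> (case_gen A B g) = \<phi> (free_gen g)"
    using has_presentation_extend[OF pres H_relators_closed group_axioms \<phi>(1)] by blast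
  interpret \<psi>: group_hom H H \<psi> by unfold_locales (rule \<psi>)
  have AB: "\<psi> A = A \<otimes> x" "\<psi> B = B \<otimes> y"
    using \<psi>(2)[of GenA] \<psi>(2)[of GenB] \<phi>(2) by simp_all
  then have C': "\<psi> C = C \<otimes> s"
    using A B comm by (simp add: C_def commutator_def)
  have "\<psi> g = g" if g: "g \<in> Z2" for g
  proof -
    obtain j i k where jik: "4 * d dvd j" "4 * d dvd i" "2 * d dvd k" and gjik: "g = nf (j, i, k)"
      using g unfolding mem_Z2_iff by (elim exE conjE)
    have "(C \<otimes> s) [^] k = C [^] k"
      using C sc s_pow[OF jik(3)] by (simp add: int_pow_mult_distrib centerD[OF s])
    then show ?thesis
      using A B C xc yc sc int_pow_mult_Z2(1)[OF x A jik(2)] int_pow_mult_Z2(1)[OF y B jik(1)]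
      by (simp add: gjik nf.simps \<psi>.hom_int_pow AB C')
  qed
  then show thesis using that \<psi>(1) AB by blast
qed

lemma hom_eqI:
  assumes G: "group G" and hom: "\<phi> \<in> hom H G" "\<psi> \<in> hom H G"
    and eq: "\<phi> A = \<psi> A" "\<phi> B = \<psi> B" and x: "x \<in> carrier H"
  shows "\<phi> x = \<psi> x"
proof -
  interpret G: group G by (rule G)
  interpret \<phi>: group_hom H G \<phi> by unfold_locales (rule hom)
  interpret \<psi>: group_hom H G \<psi> by unfold_locales (rule hom)
  have C': "\<phi> C = \<psi> C" using A B eq by (simp add: C_def commutator_def)
  obtain j i k where "x = nf (j, i, k)" by (rule nf_cases[OF x])
  then show ?thesis
    using A B C eq C' by (simp add: nf.simps \<phi>.hom_int_pow \<psi>.hom_int_pow)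
qed

definition Pi_map :: "'a \<times> 'a \<Rightarrow> 'a \<Rightarrow> 'a" where
  "Pi_map = (\<lambda>(x, y). restrict (SOME \<psi>. \<psi> \<in> hom H H \<and> \<psi> A = A \<otimes> x \<and> \<psi> B = B \<otimes> y) (carrier H))"

lemma Pi_map:
  assumes x: "x \<in> Z2" and y: "y \<in> Z2"
  shows "Pi_map (x, y) \<in> hom H H" and "Pi_map (x, y) \<in> extensional (carrier H)"
    and "Pi_map (x, y) A = A \<otimes> x" and "Pi_map (x, y) B = B \<otimes> y"
    and "\<And>z. z \<in> Z2 \<Longrightarrow> Pi_map (x, y) z = z"
proof -
  obtain \<psi> where \<psi>: "\<psi> \<in> hom H H" "\<psi> A = A \<otimes> x" "\<psi> B = B \<otimes> y" "\<And>z. z \<in> Z2 \<Longrightarrow> \<psi> z = z"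
    using Z2_endomorphism[OF x y] by blast
  define \<psi>' where "\<psi>' = (SOME \<psi>. \<psi> \<in> hom H H \<and> \<psi> A = A \<otimes> x \<and> \<psi> B = B \<otimes> y)"
  have \<psi>': "\<psi>' \<in> hom H H \<and> \<psi>' A = A \<otimes> x \<and> \<psi>' B = B \<otimes> y"
    unfolding \<psi>'_def by (rule someI[of _ \<psi>]) (simp add: \<psi>)
  have eq: "Pi_map (x, y) = restrict \<psi>' (carrier H)" by (simp add: Pi_map_def \<psi>'_def)
  show "Pi_map (x, y) \<in> hom H H"
    unfolding eq using \<psi>' by (auto simp: hom_def)
  show "Pi_map (x, y) \<in> extensional (carrier H)" unfolding eq by simp
  show "Pi_map (x, y) A = A \<otimes> x" "Pi_map (x, y) B = B \<otimes> y" unfolding eq using \<psi>' A B by simp_all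
  show "Pi_map (x, y) z = z" if "z \<in> Z2" for z
    using hom_eqI[OF group_axioms, of \<psi>' \<psi> z] \<psi> \<psi>' Z2_closed[OF that] that unfolding eq by simp
qed

lemma Pi_map_unique:
  assumes xy: "x \<in> Z2" "y \<in> Z2" and \<sigma>: "\<sigma> \<in> hom H H" "\<sigma> \<in> extensional (carrier H)" "\<sigma> A = A \<otimes> x" "\<sigma> B = B \<otimes> y"
  shows "\<sigma> = Pi_map (x, y)"
  using hom_eqI[OF group_axioms \<sigma>(1) Pi_map(1)[OF xy]] Pi_map[OF xy] \<sigma>
  by (intro extensionalityI[of _ "carrier H"]) simp_all

lemma Z2_subgroup: "subgroup Z2 H"
  unfolding Z2_def using upper_central_normal normal_imp_subgroup by blast

text \<open>The outer map fixes \<open>x'\<close>, so \<open>A \<mapsto> A x' \<mapsto> A x x'\<close>.\<close>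

lemma Pi_map_mult:
  assumes "x \<in> Z2" "y \<in> Z2" "x' \<in> Z2" "y' \<in> Z2"
  shows "compose (carrier H) (Pi_map (x, y)) (Pi_map (x', y')) = Pi_map (x \<otimes> x', y \<otimes> y')"
proof (rule Pi_map_unique)
  interpret Z2: subgroup Z2 H by (rule Z2_subgroup)
  show "x \<otimes> x' \<in> Z2" "y \<otimes> y' \<in> Z2" using assms by simp_all
  note P = Pi_map[OF assms(1,2)] and P' = Pi_map[OF assms(3,4)]
  show "compose (carrier H) (Pi_map (x, y)) (Pi_map (x', y')) \<in> hom H H"
    using hom_compose[OF P'(1) P(1)] by (auto simp: hom_def compose_def)
  show "compose (carrier H) (Pi_map (x, y)) (Pi_map (x', y')) A = A \<otimes> (x \<otimes> x')"
    "compose (carrier H) (Pi_map (x, y)) (Pi_map (x', y')) B = B \<otimes> (y \<otimes> y')"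
    using A B assms Z2_closed
    by (simp_all add: compose_eq P'(3,4) hom_mult[OF P(1)] P(3,4,5) m_assoc)
qed (simp add: compose_def)

lemma Pi_map_auto:
  assumes xy: "x \<in> Z2" "y \<in> Z2"
  shows "Pi_map (x, y) \<in> auto H"
proof -
  interpret Z2: subgroup Z2 H by (rule Z2_subgroup)
  have one: "Pi_map (\<one>, \<one>) = (\<lambda>g\<in>carrier H. g)"
    using A B by (intro Pi_map_unique[symmetric]) (auto simp: hom_def)
  have inv: "Pi_map (x, y) (Pi_map (inv x, inv y) g) = g" "Pi_map (inv x, inv y) (Pi_map (x, y) g) = g"
    if g: "g \<in> carrier H" for g
  proof -
    have "compose (carrier H) (Pi_map (x, y)) (Pi_map (inv x, inv y)) = Pi_map (\<one>, \<one>)"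
      "compose (carrier H) (Pi_map (inv x, inv y)) (Pi_map (x, y)) = Pi_map (\<one>, \<one>)"
      using xy Z2_closed by (simp_all add: Pi_map_mult)
    from this[THEN fun_cong, of g]
    show "Pi_map (x, y) (Pi_map (inv x, inv y) g) = g" "Pi_map (inv x, inv y) (Pi_map (x, y) g) = g"
      using g by (simp_all add: one compose_eq)
  qed
  have maps: "Pi_map (x, y) ` carrier H \<subseteq> carrier H" if "x \<in> Z2" "y \<in> Z2" for x y
    using Pi_map(1)[OF that] by (auto simp: hom_def)
  have "bij_betw (Pi_map (x, y)) (carrier H) (carrier H)"
    by (rule bij_betw_byWitness[where f' = "Pi_map (inv x, inv y)"])
      (use xy inv maps in simp_all)
  then show ?thesis using Pi_map[OF xy] by (simp add: auto_def Bij_def)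
qed

text \<open>The map induced on \<open>H / Z\<^sub>2(H)\<close> agrees with the identity on the images of the two generators.\<close>

lemma Pi_map_central:
  assumes xy: "x \<in> Z2" "y \<in> Z2"
  shows "Pi_map (x, y) \<in> central_autos H 2"
proof -
  interpret Z2: normal Z2 H unfolding Z2_def by (rule upper_central_normal)
  note P = Pi_map[OF xy]
  have coset: "Z2 #> (g \<otimes> z) = Z2 #> g" if "g \<in> carrier H" "z \<in> Z2" for g z
  proof -
    have "g \<otimes> z = g \<otimes> z \<otimes> inv g \<otimes> g" using that Z2_closed by (simp add: m_assoc)
    then have "g \<otimes> z \<in> Z2 #> g"
      using that Z2.inv_op_closed2[OF that] by (auto simp: r_coset_def)
    then show ?thesis using repr_independence[OF _ that(1) Z2.subgroup_axioms] by simp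
  qed
  have "Pi_map (x, y) g \<in> Z2 #> g" if g: "g \<in> carrier H" for g
  proof -
    have "((\<lambda>g. Z2 #> g) \<circ> Pi_map (x, y)) g = Z2 #> g"
    proof (rule hom_eqI[OF Z2.factorgroup_is_group])
      show "(\<lambda>g. Z2 #> g) \<circ> Pi_map (x, y) \<in> hom H (H Mod Z2)"
        by (rule Group.hom_compose[OF P(1) Z2.r_coset_hom_Mod])
    qed (use A B xy g in \<open>simp_all add: P coset Z2.r_coset_hom_Mod\<close>)
    moreover have "Pi_map (x, y) g \<in> carrier H" using P(1) g by (auto simp: hom_def)
    ultimately show ?thesis using rcos_self[OF _ Z2.subgroup_axioms] by force
  qed
  then show ?thesis
    using Pi_map_auto[OF xy] by (simp add: central_autos_iff flip: Z2_def)
qed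

lemma central_autos_eq: "central_autos H 2 = Pi_map ` (Z2 \<times> Z2)"
proof
  show "Pi_map ` (Z2 \<times> Z2) \<subseteq> central_autos H 2" using Pi_map_central by auto
  show "central_autos H 2 \<subseteq> Pi_map ` (Z2 \<times> Z2)"
  proof
    fix \<sigma> assume "\<sigma> \<in> central_autos H 2"
    then have \<sigma>: "\<sigma> \<in> hom H H" "\<sigma> \<in> extensional (carrier H)"
      and coset: "\<And>g. g \<in> carrier H \<Longrightarrow> \<sigma> g \<in> Z2 #> g"
      by (auto simp: central_autos_iff auto_def Bij_def Z2_def)
    interpret Z2: normal Z2 H unfolding Z2_def by (rule upper_central_normal)
    have *: "\<exists>x\<in>Z2. \<sigma> g = g \<otimes> x" if g: "g \<in> carrier H" for g
      using coset[OF g] Z2.coset_eq g by (auto simp: l_coset_def)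
    from *[OF A] obtain x where x: "x \<in> Z2" "\<sigma> A = A \<otimes> x" by blast
    from *[OF B] obtain y where y: "y \<in> Z2" "\<sigma> B = B \<otimes> y" by blast
    have "\<sigma> = Pi_map (x, y)" by (rule Pi_map_unique[OF x(1) y(1) \<sigma> x(2) y(2)])
    then show "\<sigma> \<in> Pi_map ` (Z2 \<times> Z2)" using x y by blast
  qed
qed

lemma Pi_map_inj: "inj_on Pi_map (Z2 \<times> Z2)"
proof (rule inj_onI, clarify)
  fix x y x' y' assume xy: "x \<in> Z2" "y \<in> Z2" "x' \<in> Z2" "y' \<in> Z2" and eq: "Pi_map (x, y) = Pi_map (x', y')"
  then have "A \<otimes> x = A \<otimes> x'" "B \<otimes> y = B \<otimes> y'"
    using Pi_map(3,4)[of x y] Pi_map(3,4)[of x' y'] by simp_all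
  then show "x = x' \<and> y = y'" using A B xy Z2_closed by simp
qed

lemma card_central_autos: "card (central_autos H 2) = 2 ^ (6 * m - 4)"
proof -
  have "card (central_autos H 2) = 2 ^ (3 * m - 2 + (3 * m - 2))"
    unfolding central_autos_eq card_image[OF Pi_map_inj] card_cartesian_product card_Z2 by (simp only: power_add)
  also have "3 * m - 2 + (3 * m - 2) = 6 * m - 4" using m by simp
  finally show ?thesis .
qed

lemma Pi_map_hom:
  "Pi_map \<in> hom (H\<lparr>carrier := Z2\<rparr> \<times>\<times> H\<lparr>carrier := Z2\<rparr>) (AutoGroup H)"
proof (rule homI)
  fix p p' assume p: "p \<in> carrier (H\<lparr>carrier := Z2\<rparr> \<times>\<times> H\<lparr>carrier := Z2\<rparr>)"
    "p' \<in> carrier (H\<lparr>carrier := Z2\<rparr> \<times>\<times> H\<lparr>carrier := Z2\<rparr>)"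
  then show "Pi_map p \<in> carrier (AutoGroup H)"
    using Pi_map_auto by (auto simp: AutoGroup_def DirProd_def)
  show "Pi_map (p \<otimes>\<^bsub>H\<lparr>carrier := Z2\<rparr> \<times>\<times> H\<lparr>carrier := Z2\<rparr>\<^esub> p') =
      Pi_map p \<otimes>\<^bsub>AutoGroup H\<^esub> Pi_map p'"
    using p Pi_map_auto Pi_map_mult
    by (auto simp: AutoGroup_def BijGroup_def DirProd_def auto_def)
qed

end

theorem proposition6p6:
  fixes H :: "('a, 'b) monoid_scheme" and A B :: 'a and m :: nat and l :: int
  assumes "m > 1" and "odd l"
    and "has_presentation H (case_gen A B) (H_relators m l)"
  shows "\<exists>P.
      (\<forall>x \<in> upper_central H 2. \<forall>y \<in> upper_central H 2.
          P (x, y) \<in> central_autos H 2 \<and>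
          P (x, y) A = A \<otimes>\<^bsub>H\<^esub> x \<and> P (x, y) B = B \<otimes>\<^bsub>H\<^esub> y \<and>
          (\<forall>z \<in> upper_central H 2. P (x, y) z = z)) \<and>
      P \<in> hom (H\<lparr>carrier := upper_central H 2\<rparr> \<times>\<times> H\<lparr>carrier := upper_central H 2\<rparr>)
               (AutoGroup H) \<and>
      inj_on P (upper_central H 2 \<times> upper_central H 2) \<and>
      P ` (upper_central H 2 \<times> upper_central H 2) = central_autos H 2 \<and>
      card (central_autos H 2) = 2 ^ (6 * m - 4)"
proof -
  interpret H_presentation H A B m l
    by unfold_locales (rule assms)+
  show ?thesis
    using Pi_map(3,4,5) Pi_map_central Pi_map_hom Pi_map_inj central_autos_eq card_central_autos
    unfolding Z2_def by (intro exI[of _ Pi_map]) simp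
qed

end
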